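(* Let $j,k$ be complex numbers with $k\neq 0,-2$. Then the following assignment gives a level $k$ representation of the affine Lie algebra $\widehat{\mathfrak{sl}}_2$ (in its principal realization) on the Fock space $\mathcal{F}_{j,k}$: $$\beta(\zeta)=\frac12 D\phi_0(\zeta),$$ $$x(\zeta)=\frac12 :\bigl(D\phi_1(\zeta)+D\phi_2(\zeta)\bigr)\,e^{\frac{\phi_2(\zeta)}{k}+\frac{\phi_0(\zeta)}{k}}:,$$ $$c=k\cdot\mathrm{id},\qquad \rho=-d,$$ where $\beta(\zeta)=\sum_{n\ \mathrm{odd}}\beta_n\zeta^{-n}$ and $x(\zeta)=\sum_{n\in\mathbb{Z}}x_n\zeta^{-n}$ are the generating series of $\widehat{\mathfrak{sl}}_2$, and each equality of series means that the operator representing $\beta_n$ (respectively $x_n$) is the coefficient of $\zeta^{-n}$ on the right-hand side.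
   Context: **The affine Lie algebra in the principal picture.** Let $e,f,h$ be the standard generators of $\mathfrak{g}=\mathfrak{sl}_2$ over $\mathbb{C}$: $[h,e]=2e$, $[h,f]=-2f$, $[e,f]=h$. The invariant bilinear form is normalized by $(e,f)=1$, $(h,h)=2$. Let $\mathfrak{g}_0=\mathbb{C}h$ and $\mathfrak{g}_1=\mathbb{C}e\oplus\mathbb{C}f$. As a vector space, $$\widehat{\mathfrak{sl}}_2=\mathfrak{g}_0\otimes\mathbb{C}[t^2,t^{-2}]\ \oplus\ \mathfrak{g}_1\otimes t\,\mathbb{C}[t^2,t^{-2}]\ \oplus\ \mathbb{C}c\oplus\mathbb{C}\rho,$$ with Lie bracket $$[a\otimes t^m,b\otimes t^n]=[a,b]\otimes t^{m+n}+\tfrac12(a,b)\,m\,c\,\delta_{m+n,0},\qquad c \text{ central},\qquad [\rho,a\otimes t^m]=m\,a\otimes t^m .$$ Set $\beta_n=(e+f)\otimes t^n$ for $n$ odd; $x_n=h\otimes t^n$ for $n$ even and $x_n=(-e+f)\otimes t^n$ for $n$ odd. The elements $\beta_n$ ($n$ odd), $x_n$ ($n\in\mathbb{Z}$), $c$, $\rho$ form a basis of $\widehat{\mathfrak{sl}}_2$. In terms of the generating series $\beta(\zeta)=\sum_{n\ \mathrm{odd}}\beta_n\zeta^{-n}$, $x(\zeta)=\sum_{n\in\mathbb{Z}}x_n\zeta^{-n}$, with $\delta(\zeta)=\sum_{m\in\mathbb{Z}}\zeta^m$ and $D=D_\zeta=\zeta\frac{d}{d\zeta}$ (so $(D\delta)(z)=\sum_{m}m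 z^m$), the commutation relations read $$[\beta(\zeta),\beta(\xi)]=\tfrac{c}{2}\bigl((D\delta)(\xi/\zeta)-(D\delta)(-\xi/\zeta)\bigr),$$ $$[\beta(\zeta),x(\xi)]=\bigl(\delta(\xi/\zeta)-\delta(-\xi/\zeta)\bigr)x(\xi),$$ $$[x(\zeta),x(\xi)]=-2\,\delta(-\xi/\zeta)\,\beta(\xi)+c\,(D\delta)(-\xi/\zeta).$$ A representation has level $k$ if $c$ acts as $k$ times the identity. **Bosonic fields.** Consider $$\phi_1(\zeta)=-\sum_{n\ \mathrm{even},\,n\neq0}\frac{\phi_{1,n}}{n}\zeta^{-n}+\phi_{1,0}\log\zeta+Q,\qquad \phi_i(\zeta)=-\sum_{n\ \mathrm{odd}}\frac{\phi_{i,n}}{n}\zeta^{-n}\quad(i=0,2),$$ so that $D\phi_1(\zeta)=\sum_{n\ \mathrm{even}}\phi_{1,n}\zeta^{-n}$ and $D\phi_i(\zeta)=\sum_{n\ \mathrm{odd}}\phi_{i,n}\zeta^{-n}$ for $i=0,2$. The modes satisfy $$[\phi_{1,m},\phi_{1,n}]=4(k+2)m\,\delta_{m+n,0},\quad [\phi_{1,0},Q]=4(k+2),\quad [\phi_{0,m},\phi_{0,n}]=4km\,\delta_{m+n,0},\quad [\phi_{2,m},\phi_{2,n}]=-4km\,\delta_{m+n,0},$$ all other commutators being $0$. **Fock space.** For $j\in\mathbb{C}$, $$\mathcal{F}_{j,k}=\mathbb{C}[\phi_{0,-n},\phi_{2,-n}\ (n=1,3,5,\dots),\ \phi_{1,-n}\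 (n=2,4,6,\dots)]\,|j,k\rangle$$ is the Fock space generated on the vacuum $|j,k\rangle$, where $\phi_{i,n}|j,k\rangle=0$ for $n>0$, $i=0,1,2$, $\phi_{1,0}|j,k\rangle=2j\,|j,k\rangle$, and $e^{Q/(2(k+2))}|j,k\rangle=|j+1,k\rangle$. The grading operator $d:\mathcal{F}_{j,k}\to\mathcal{F}_{j,k}$ is determined by $$[d,\phi_{i,n}]=-n\,\phi_{i,n},\quad [d,Q]=\phi_{1,0},\quad d|j,k\rangle=\frac{2j^2+k}{4(k+2)}|j,k\rangle .$$ **Normal ordering.** The symbol $:\cdots:$ denotes the usual bosonic normal ordering: modes $\phi_{i,n}$ with $n<0$ (and $Q$) are placed to the left of modes $\phi_{i,n}$ with $n>0$ (and $\phi_{1,0}$). For example, $:e^{\phi_1(\zeta)}:\,=e^{\sum_{n\ge1}\frac{\phi_{1,-2n}}{2n}\zeta^{2n}}e^{-\sum_{n\ge1}\frac{\phi_{1,2n}}{2n}\zeta^{-2n}}e^{Q}\zeta^{\phi_{1,0}}$. *)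

theory Defs
  imports "HOL-Analysis.Analysis" "HOL-Library.Poly_Mapping"
begin

section \<open>The affine Lie algebra in the principal picture\<close>

type_synonym mat2 = "complex ^ 2 ^ 2"

definition sl2_e :: mat2 where "sl2_e = vector [vector [0, 1], vector [0, 0]]"
definition sl2_f :: mat2 where "sl2_f = vector [vector [0, 0], vector [1, 0]]"
definition sl2_h :: mat2 where "sl2_h = vector [vector [1, 0], vector [0, -1]]"

definition mat_scale :: "complex \<Rightarrow> mat2 \<Rightarrow> mat2" where
  "mat_scale r a = (\<chi> i l. r * a $ i $ l)"

definition mat_bracket :: "mat2 \<Rightarrow> mat2 \<Rightarrow> mat2" where
  "mat_bracket a b = a ** b - b ** a"

text \<open>The trace form is the invariant form with $(e,f) = 1$ and $(h,h) = 2$.\<close>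

definition inv_form :: "mat2 \<Rightarrow> mat2 \<Rightarrow> complex" where
  "inv_form a b = trace (a ** b)"

text \<open>A triple \<open>(u, r, s)\<close> stands for $\sum_m u_m \otimes t^m + r c + s \rho$.\<close>

type_synonym affine = "(int \<Rightarrow>\<^sub>0 mat2) \<times> complex \<times> complex"

definition affine_sl2 :: "affine set" where
  "affine_sl2 = {(u, r, s) | u r s. \<forall>m.
     (even m \<longrightarrow> (\<exists>x. Poly_Mapping.lookup u m = mat_scale x sl2_h)) \<and>
     (odd m \<longrightarrow> (\<exists>x y. Poly_Mapping.lookup u m = mat_scale x sl2_e + mat_scale y sl2_f))}"

definition affine_scale :: "complex \<Rightarrow> affine \<Rightarrow> affine" where
  "affine_scale z = (\<lambda>(u, r, s). (Poly_Mapping.map (mat_scale z) u, z * r, z * s))"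

definition loop_bracket :: "(int \<Rightarrow>\<^sub>0 mat2) \<Rightarrow> (int \<Rightarrow>\<^sub>0 mat2) \<Rightarrow> (int \<Rightarrow>\<^sub>0 mat2)" where
  "loop_bracket u v = (\<Sum>m\<in>Poly_Mapping.keys u. \<Sum>n\<in>Poly_Mapping.keys v.
     Poly_Mapping.single (m + n) (mat_bracket (Poly_Mapping.lookup u m) (Poly_Mapping.lookup v n)))"

definition cocycle :: "(int \<Rightarrow>\<^sub>0 mat2) \<Rightarrow> (int \<Rightarrow>\<^sub>0 mat2) \<Rightarrow> complex" where
  "cocycle u v = (\<Sum>m\<in>Poly_Mapping.keys u. \<Sum>n\<in>Poly_Mapping.keys v.
     if m + n = 0 then 1/2 * inv_form (Poly_Mapping.lookup u m) (Poly_Mapping.lookup v n) * of_int m else 0)"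

definition loop_deriv :: "(int \<Rightarrow>\<^sub>0 mat2) \<Rightarrow> (int \<Rightarrow>\<^sub>0 mat2)" where
  "loop_deriv u = (\<Sum>m\<in>Poly_Mapping.keys u. Poly_Mapping.single m (mat_scale (of_int m) (Poly_Mapping.lookup u m)))"

definition affine_bracket :: "affine \<Rightarrow> affine \<Rightarrow> affine" where
  "affine_bracket = (\<lambda>(u, r, s) (u', r', s').
     (loop_bracket u u' + Poly_Mapping.map (mat_scale s) (loop_deriv u')
        - Poly_Mapping.map (mat_scale s') (loop_deriv u),
      cocycle u u', 0))"

definition tensor_t :: "mat2 \<Rightarrow> int \<Rightarrow> affine" where
  "tensor_t a m = (Poly_Mapping.single m a, 0, 0)"

definition c_elem :: affine where "c_elem = (0, 1, 0)"
definition rho_elem :: affine where "rho_elem = (0, 0, 1)"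

text \<open>\<open>beta_elem n\<close> belongs to the Lie algebra only for odd \<open>n\<close>.\<close>

definition beta_elem :: "int \<Rightarrow> affine" where
  "beta_elem n = tensor_t (sl2_e + sl2_f) n"

definition x_elem :: "int \<Rightarrow> affine" where
  "x_elem n = (if even n then tensor_t sl2_h n else tensor_t (- sl2_e + sl2_f) n)"


lemma mat_scale_simps [simp]: "mat_scale z 0 = 0" "mat_scale 0 a = 0" "mat_scale 1 a = a"
  by (simp_all add: mat_scale_def vec_eq_iff)

lemma map_mat_scale_simps [simp]:
  "Poly_Mapping.map (mat_scale z) 0 = 0" "Poly_Mapping.map (mat_scale 0) u = 0"
  by (rule poly_mapping_eqI, simp add: Poly_Mapping.map.rep_eq when_def)+

lemma affine_bracket_tensor:
  "affine_bracket (tensor_t a m) (tensor_t b n) =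
     tensor_t (mat_bracket a b) (m + n) +
     affine_scale (if m + n = 0 then 1/2 * inv_form a b * of_int m else 0) c_elem"
proof -
  have [simp]: "mat_bracket 0 b = 0" "mat_bracket a 0 = 0" "inv_form 0 b = 0" "inv_form a 0 = 0"
    for a b
    by (simp_all add: mat_bracket_def inv_form_def trace_def)
  show ?thesis
    by (cases "a = 0"; cases "b = 0")
       (simp_all add: affine_bracket_def tensor_t_def affine_scale_def c_elem_def loop_bracket_def
         cocycle_def loop_deriv_def)
qed

lemma affine_bracket_rho: "affine_bracket rho_elem (tensor_t a m) = affine_scale (of_int m) (tensor_t a m)"
  by (cases "a = 0")
     (simp_all add: affine_bracket_def tensor_t_def affine_scale_def rho_elem_def loop_bracket_def
       cocycle_def loop_deriv_def)

lemma sl2_relations: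
  "mat_bracket sl2_h sl2_e = mat_scale 2 sl2_e"
  "mat_bracket sl2_h sl2_f = mat_scale (-2) sl2_f"
  "mat_bracket sl2_e sl2_f = sl2_h"
  "inv_form sl2_e sl2_f = 1" "inv_form sl2_h sl2_h = 2"
  by (simp_all add: mat_bracket_def inv_form_def sl2_e_def sl2_f_def sl2_h_def mat_scale_def
      matrix_matrix_mult_def trace_def sum_2 vec_eq_iff forall_2)


section \<open>The Fock space\<close>

text \<open>\<open>is_mode i n\<close>: the mode $\phi_{i,n}$ exists.\<close>

definition is_mode :: "nat \<Rightarrow> int \<Rightarrow> bool" where
  "is_mode i n \<longleftrightarrow> i = 1 \<and> even n \<or> i \<in> {0, 2} \<and> odd n"

typedef creation = "{(i, n). is_mode i n \<and> n < 0}"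
  by (rule exI[of _ "(0, -1)"]) (simp add: is_mode_def)

text \<open>
  Polynomials in the creation modes, as finitely supported functions on monomials.
  The vacuum $|j,k\rangle$ is the polynomial \<open>1\<close>; the space does not depend on $j$ and $k$,
  which enter through the operators.
\<close>

type_synonym fock = "(creation \<Rightarrow>\<^sub>0 nat) \<Rightarrow>\<^sub>0 complex"

definition fscale :: "complex \<Rightarrow> fock \<Rightarrow> fock" where
  "fscale z p = Poly_Mapping.single 0 z * p"

definition fvar :: "creation \<Rightarrow> fock" where
  "fvar v = Poly_Mapping.single (Poly_Mapping.single v 1) 1"

definition fderiv :: "creation \<Rightarrow> fock \<Rightarrow> fock" where
  "fderiv v p = (\<Sum>a\<in>Poly_Mapping.keys p.
     Poly_Mapping.single (a - Poly_Mapping.single v 1) (of_nat (Poly_Mapping.lookup a v) * Poly_Mapping.lookup p a))"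

text \<open>$[\phi_{i,m}, \phi_{i,n}] = \<open>kappa k i\<close> \cdot m \delta_{m+n,0}$.\<close>

definition kappa :: "complex \<Rightarrow> nat \<Rightarrow> complex" where
  "kappa k i = (if i = 0 then 4 * k else if i = 1 then 4 * (k + 2) else - 4 * k)"

text \<open>The action of $\phi_{i,n}$ on $\mathcal{F}_{j,k}$, set to zero if there is no such mode.\<close>

definition phi :: "complex \<Rightarrow> complex \<Rightarrow> nat \<Rightarrow> int \<Rightarrow> fock \<Rightarrow> fock" where
  "phi j k i n p =
     (if \<not> is_mode i n then 0
      else if n < 0 then fvar (Abs_creation (i, n)) * p
      else if n = 0 then fscale (2 * j) p
      else fscale (kappa k i * of_int n) (fderiv (Abs_creation (i, - n)) p))"

definition mono_deg :: "(creation \<Rightarrow>\<^sub>0 nat) \<Rightarrow> int" where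
  "mono_deg a = (\<Sum>v\<in>Poly_Mapping.keys a. int (Poly_Mapping.lookup a v) * (- snd (Rep_creation v)))"

definition grading :: "complex \<Rightarrow> complex \<Rightarrow> fock \<Rightarrow> fock" where
  "grading j k p = (\<Sum>a\<in>Poly_Mapping.keys p. Poly_Mapping.single a
     (((2 * j\<^sup>2 + k) / (4 * (k + 2)) + of_int (mono_deg a)) * Poly_Mapping.lookup p a))"


lemma vector_space_fscale: "vector_space fscale"
  by unfold_locales
     (simp_all add: fscale_def algebra_simps single_add mult_single flip: mult.assoc)

lemma fderiv_single:
  "fderiv v (Poly_Mapping.single a z) =
     Poly_Mapping.single (a - Poly_Mapping.single v 1) (of_nat (Poly_Mapping.lookup a v) * z)"
  by (cases "z = 0") (simp_all add: fderiv_def)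

lemma fderiv_zero [simp]: "fderiv v 0 = 0"
  by (simp add: fderiv_def)

lemma fderiv_add: "fderiv v (p + q) = fderiv v p + fderiv v q"
  unfolding fderiv_def
  by (rule setsum_keys_plus_distrib) (simp_all add: single_add distrib_left)

lemma grading_single:
  "grading j k (Poly_Mapping.single a z) =
     Poly_Mapping.single a (((2 * j\<^sup>2 + k) / (4 * (k + 2)) + of_int (mono_deg a)) * z)"
  by (cases "z = 0") (simp_all add: grading_def)

lemma grading_add: "grading j k (p + q) = grading j k p + grading j k q"
  unfolding grading_def
  by (rule setsum_keys_plus_distrib) (simp_all add: single_add distrib_left)

lemma fock_induct [case_names zero single add]:
  fixes p :: fock
  assumes "P 0" "\<And>a z. P (Poly_Mapping.single a z)" "\<And>p q. P p \<Longrightarrow> P q \<Longrightarrow> P (p + q)"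
  shows "P p"
proof (induction p rule: update_induct)
  case (update f a b)
  have "Poly_Mapping.update a b f = f + Poly_Mapping.single a b"
    using update(1)
    by (intro poly_mapping_eqI)
       (auto simp: lookup_update lookup_add lookup_single in_keys_iff when_def)
  then show ?case using assms update by simp
qed (fact assms)

lemma fderiv_mult_fvar: "fderiv v (fvar w * p) = (if v = w then p else 0) + fvar w * fderiv v p"
proof (induction p rule: fock_induct)
  case (single a z)
  let ?v = "Poly_Mapping.single v (1::nat)" and ?w = "Poly_Mapping.single w (1::nat)"
  show ?case
  proof (cases "v = w")
    case True
    have "?w + (a - ?w) = a" if "Poly_Mapping.lookup a w \<noteq> 0"
      using that by (intro poly_mapping_eqI) (auto simp: lookup_add lookup_minus lookup_single when_def)
    then show ?thesis using True
      by (cases "Poly_Mapping.lookup a w = 0")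
         (simp_all add: fvar_def mult_single fderiv_single lookup_add distrib_right flip: single_add)
  next
    case False
    have "?w + a - ?v = ?w + (a - ?v)"
      using False by (intro poly_mapping_eqI) (auto simp: lookup_add lookup_minus lookup_single when_def)
    then show ?thesis using False
      by (simp add: fvar_def mult_single fderiv_single lookup_add lookup_single)
  qed
qed (simp_all add: fderiv_add distrib_left)

lemma fderiv_commute: "fderiv v (fderiv w p) = fderiv w (fderiv v p)"
proof (induction p rule: fock_induct)
  case (single a z)
  have "a - Poly_Mapping.single v (1::nat) - Poly_Mapping.single w 1
      = a - Poly_Mapping.single w 1 - Poly_Mapping.single v 1"
    by (intro poly_mapping_eqI) (simp add: lookup_minus)
  then show ?case
    by (cases "v = w") (simp_all add: fderiv_single lookup_minus lookup_single mult.left_commute)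
qed (simp_all add: fderiv_add)

lemma fderiv_fscale: "fderiv v (fscale z p) = fscale z (fderiv v p)"
proof (induction p rule: fock_induct)
  case (single a y)
  show ?case by (simp add: fscale_def mult_single fderiv_single mult_ac)
qed (simp_all add: fderiv_add fscale_def distrib_left)

lemma phi_commutator:
  assumes "is_mode i m" "is_mode l n"
  shows "phi j k i m (phi j k l n p) - phi j k l n (phi j k i m p) =
           fscale (if i = l \<and> m + n = 0 then kappa k i * of_int m else 0) p"
proof -
  have scale: "fscale z 0 = 0" "fscale z (fvar w * q) = fvar w * fscale z q"
      "fscale z (q + r) = fscale z q + fscale z r" "fscale 0 q = 0"
      "fscale z (- q) = fscale (- z) q" "- fscale z q = fscale (- z) q" for z w q r
    by (simp_all add: fscale_def algebra_simps single_uminus)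
  have swap: "fscale z (fscale y q) = fscale y (fscale z q)" for z y q
    by (simp add: fscale_def mult_ac)
  have Abs: "Abs_creation (i, m) = Abs_creation (l, n) \<longleftrightarrow> i = l \<and> m = n"
    if "is_mode i m" "is_mode l n" "m < 0" "n < 0" for i m l n
    using that by (subst Abs_creation_inject) auto
  have *: "is_mode i (- m) \<longleftrightarrow> is_mode i m" for i m by (simp add: is_mode_def)
  have zero: "m = 0 \<Longrightarrow> i = 1" "n = 0 \<Longrightarrow> l = 1" using assms by (auto simp: is_mode_def)
  consider "m < 0" "n < 0" | "m < 0" "n = 0" | "m < 0" "n > 0" | "m = 0" "n < 0" | "m = 0" "n = 0"
    | "m = 0" "n > 0" | "m > 0" "n < 0" | "m > 0" "n = 0" | "m > 0" "n > 0" by linarith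
  then show ?thesis
  proof cases
    case 3
    have "i = l \<and> n = - m \<longleftrightarrow> i = l \<and> m + n = 0" by auto
    then show ?thesis using 3 assms
      by (auto simp: phi_def fderiv_mult_fvar scale Abs * fderiv_fscale)
  next
    case 7
    then show ?thesis using assms
      by (auto simp: phi_def fderiv_mult_fvar scale Abs * fderiv_fscale)
  next
    case 9
    then show ?thesis using assms
      by (simp add: phi_def scale fderiv_fscale fderiv_commute[of "Abs_creation (i, - m)"] swap)
  qed (use assms in \<open>auto simp: phi_def scale fderiv_fscale swap mult.left_commute\<close>)
qed

lemma phi_vacuum: "n > 0 \<Longrightarrow> phi j k i n 1 = 0" "phi j k 1 0 1 = fscale (2 * j) 1"
  by (simp_all add: phi_def is_mode_def fscale_def fderiv_single flip: single_one)

lemma mono_deg_add: "mono_deg (a + b) = mono_deg a + mono_deg b"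
  unfolding mono_deg_def
  by (rule setsum_keys_plus_distrib) (simp_all add: distrib_right)

lemma grading_phi:
  "grading j k (phi j k i n p) - phi j k i n (grading j k p) = fscale (- of_int n) (phi j k i n p)"
proof (cases "is_mode i n")
  case False
  then show ?thesis by (simp add: phi_def grading_def fscale_def)
next
  case True
  have deg: "mono_deg (Poly_Mapping.single (Abs_creation (i, m)) (Suc 0)) = - m"
    if "is_mode i m" "m < 0" for m
    using that by (simp add: mono_deg_def Abs_creation_inverse)
  have mode: "is_mode i (- n)" using True by (simp add: is_mode_def)
  show ?thesis
  proof (induction p rule: fock_induct)
    case zero
    show ?case by (simp add: phi_def grading_def fscale_def)
  next
    case (add p q)
    have "phi j k i n (p + q) = phi j k i n p + phi j k i n q" for p q
      by (simp add: phi_def fscale_def fderiv_add distrib_left)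
    with add show ?case by (simp add: grading_add fscale_def algebra_simps)
  next
    case (single a z)
    consider "n < 0" | "n = 0" | "n > 0" by linarith
    then show ?case
    proof cases
      case 1
      then show ?thesis using True
        by (simp add: phi_def fvar_def mult_single grading_single mono_deg_add deg fscale_def
            algebra_simps flip: single_diff)
    next
      case 2
      then show ?thesis using True
        by (simp add: phi_def mult_single grading_single fscale_def mult_ac)
    next
      case 3
      let ?v = "Abs_creation (i, - n)"
      have "mono_deg a = mono_deg (a - Poly_Mapping.single ?v 1) + n"
        if "Poly_Mapping.lookup a ?v \<noteq> 0"
      proof -
        have "a = (a - Poly_Mapping.single ?v 1) + Poly_Mapping.single ?v 1"
          using that
          by (intro poly_mapping_eqI) (auto simp: lookup_add lookup_minus lookup_single when_def)
        then show ?thesis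
          using mono_deg_add deg[of "- n"] mode 3
          by (metis add.inverse_inverse neg_less_0_iff_less One_nat_def)
      qed
      then show ?thesis using True 3
        by (cases "Poly_Mapping.lookup a ?v = 0")
           (simp_all add: phi_def fderiv_single mult_single grading_single fscale_def
            grading_def[of j k 0] algebra_simps flip: single_diff)
    qed
  qed
qed

lemma grading_vacuum: "grading j k 1 = fscale ((2 * j\<^sup>2 + k) / (4 * (k + 2))) 1"
  using grading_single[of j k 0 1] by (simp add: fscale_def mono_deg_def)


section \<open>Operator-valued formal series\<close>

text \<open>\<open>A\<close> stands for $A(\zeta) = \sum_n A_n \zeta^{-n}$, in both directions infinite.\<close>

type_synonym field_op = "int \<Rightarrow> fock \<Rightarrow> fock"

definition series_add :: "field_op \<Rightarrow> field_op \<Rightarrow> field_op" where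
  "series_add A B = (\<lambda>n v. A n v + B n v)"

definition series_scale :: "complex \<Rightarrow> field_op \<Rightarrow> field_op" where
  "series_scale z A = (\<lambda>n v. fscale z (A n v))"

text \<open>$D = \zeta\, d/d\zeta$.\<close>

definition series_D :: "field_op \<Rightarrow> field_op" where
  "series_D A = (\<lambda>n v. fscale (- of_int n) (A n v))"

text \<open>
  \<open>Sum_any\<close> is the sum of the nonzero terms, and \<open>0\<close> if there are infinitely many of them.
  The products and exponentials formed below are locally finite: for each vector and each power
  of $\zeta$ only finitely many terms are nonzero, because annihilation modes lower
  the degree of a vector and the factors $e^{X_\pm}$ only contain powers of $\zeta$ of one sign.
\<close>

definition series_mult :: "field_op \<Rightarrow> field_op \<Rightarrow> field_op" where
  "series_mult A B = (\<lambda>n v. Sum_any (\<lambda>m. A m (B (n - m) v)))"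

definition series_one :: field_op where
  "series_one = (\<lambda>n v. if n = 0 then v else 0)"

definition series_power :: "field_op \<Rightarrow> nat \<Rightarrow> field_op" where
  "series_power A r = (series_mult A ^^ r) series_one"

definition series_exp :: "field_op \<Rightarrow> field_op" where
  "series_exp A = (\<lambda>n v. Sum_any (\<lambda>r. fscale (1 / fact r) (series_power A r n v)))"

definition creation_part :: "field_op \<Rightarrow> field_op" where
  "creation_part A = (\<lambda>n v. if n < 0 then A n v else 0)"

definition annihilation_part :: "field_op \<Rightarrow> field_op" where
  "annihilation_part A = (\<lambda>n v. if n \<ge> 0 then A n v else 0)"

text \<open>
  Normal ordering, for series linear in the modes: $:e^X: \; = e^{X_-} e^{X_+}$ and
  $:A e^X: \; = A_- e^{X_-} e^{X_+} + e^{X_-} e^{X_+} A_+$, where $A_+$ includes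
  the zero mode.
\<close>

definition normal_exp :: "field_op \<Rightarrow> field_op" where
  "normal_exp X = series_mult (series_exp (creation_part X)) (series_exp (annihilation_part X))"

definition normal_mult_exp :: "field_op \<Rightarrow> field_op \<Rightarrow> field_op" where
  "normal_mult_exp A X =
     series_add (series_mult (creation_part A) (normal_exp X))
                (series_mult (normal_exp X) (annihilation_part A))"


section \<open>The bosonic fields and the proposed currents\<close>

text \<open>
  $\phi_i(\zeta)$ for $i = 0, 2$. The field $\phi_1(\zeta)$ involves $\log\zeta$ and $Q$, which does
  not act on a single $\mathcal{F}_{j,k}$; only $D\phi_1(\zeta)$ is needed.
\<close>

definition phi_series :: "complex \<Rightarrow> complex \<Rightarrow> nat \<Rightarrow> field_op" where
  "phi_series j k i = (\<lambda>n v. fscale (- 1 / of_int n) (phi j k i n v))"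

definition Dphi1_series :: "complex \<Rightarrow> complex \<Rightarrow> field_op" where
  "Dphi1_series j k = phi j k 1"

definition beta_series :: "complex \<Rightarrow> complex \<Rightarrow> field_op" where
  "beta_series j k = series_scale (1/2) (series_D (phi_series j k 0))"

definition x_series :: "complex \<Rightarrow> complex \<Rightarrow> field_op" where
  "x_series j k = series_scale (1/2)
     (normal_mult_exp
        (series_add (Dphi1_series j k) (series_D (phi_series j k 2)))
        (series_add (series_scale (1/k) (phi_series j k 2))
                    (series_scale (1/k) (phi_series j k 0))))"


section \<open>Representations\<close>

definition is_affine_rep :: "(affine \<Rightarrow> fock \<Rightarrow> fock) \<Rightarrow> bool" where
  "is_affine_rep \<pi> \<longleftrightarrow>
     (\<forall>a\<in>affine_sl2. Vector_Spaces.linear fscale fscale (\<pi> a)) \<and>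
     (\<forall>a\<in>affine_sl2. \<forall>b\<in>affine_sl2. \<forall>v. \<pi> (a + b) v = \<pi> a v + \<pi> b v) \<and>
     (\<forall>z. \<forall>a\<in>affine_sl2. \<forall>v. \<pi> (affine_scale z a) v = fscale z (\<pi> a v)) \<and>
     (\<forall>a\<in>affine_sl2. \<forall>b\<in>affine_sl2. \<forall>v.
        \<pi> (affine_bracket a b) v = \<pi> a (\<pi> b v) - \<pi> b (\<pi> a v))"

definition has_level :: "complex \<Rightarrow> (affine \<Rightarrow> fock \<Rightarrow> fock) \<Rightarrow> bool" where
  "has_level k \<pi> \<longleftrightarrow> (\<forall>v. \<pi> c_elem v = fscale k v)"

end

theory Submission
  imports Defs
begin

text \<open>
  Write $X = (\phi_2 + \phi_0)/k$, $E = {:}e^X{:}$, $A = D\phi_1 + D\phi_2$ and $J = {:}AE{:}$, so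
  that $x(\zeta) = \frac12 J(\zeta)$ and $\beta(\zeta) = \frac12 D\phi_0(\zeta)$; these series are
  called \<open>exponent\<close>, \<open>vertex\<close>, \<open>boson\<close> and \<open>current\<close> below. The commutators of
  the modes of $\phi_0$ and of $\phi_2$ differ by a sign. Therefore the modes of $X$ commute with
  each other, and so do the modes of $E$. For a single mode of a boson the Leibniz rule gives
  \[ [\phi_{l,r}, E_n] = c_l E_{n+r}, \qquad
     [\phi_{l,r}, J_n] = r b_l E_{n+r} + c_l J_{n+r} \]
  with $c_0 = 4$, $c_1 = 0$, $c_2 = -4$ and $b_0 = 0$, $b_1 = 4(k+2)$, $b_2 = -4k$
  (\<open>mode_vertex\<close>, \<open>mode_current\<close>). The case $l = 0$ contains the brackets with $\beta$,
  and the brackets with $\rho$ only say that the operators are homogeneous.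

  The substance is $[J_m, J_n] = 4(-1)^m (m k \delta_{m+n,0} - \phi_{0,m+n})$. An operator product
  expansion would prove it by rearranging doubly infinite sums. The proof here avoids them by a
  uniqueness argument (\<open>graded_operators_zero\<close>). Let $R_{m,n}$ be the difference of the two sides.
  The formulas above imply $[\phi_{l,r}, R_{m,n}] = c_l (R_{m+r,n} + R_{m,n+r})$. The vector
  $R_{m,n}|j,k\rangle$ has degree $-(m+n)$, so it vanishes if $m + n > 0$. If $m + n < 0$ and
  all $R_{m',n'}$ with $m'+n' > m+n$ annihilate the vacuum, then $R_{m,n}|j,k\rangle$ is annihilated
  by all $\phi_{l,r}$ with $r > 0$; since $k \neq 0, -2$, these act as nonzero multiples of all
  the partial derivatives, and a polynomial of positive degree is not killed by all of them. Thus
  everything on the vacuum reduces to $m + n = 0$, and from the vacuum the creation modes carry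
  $R = 0$ to the whole Fock space. The remaining value $[J_m, J_{-m}]|j,k\rangle$ is a finite sum
  (\<open>current_current_vacuum_pos\<close>).

  Computing $[\phi_{l,r}, R_{m,n}]$ requires one relation between the modes of $E$, namely
  $E(-\zeta)E(\zeta) = 1$, because $[E_a, J_n]$ is a sum of products $E_{a+p}E_{n-p}$ over odd $p$.
  The same uniqueness argument proves this relation (\<open>signed_pairs_eq\<close>).
\<close>

section \<open>Linear operators and locally finite sums\<close>

interpretation fock: vector_space_pair fscale fscale
  by (simp add: vector_space_pair_def vector_space_fscale)

abbreviation flinear :: "(fock \<Rightarrow> fock) \<Rightarrow> bool" where
  "flinear \<equiv> Vector_Spaces.linear fscale fscale"

lemmas fscale_simps = fock.vs1.scale_right_distrib fock.vs1.scale_right_diff_distrib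

lemma flinearI:
  assumes "\<And>v w. T (v + w) = T v + T w" "\<And>z v. T (fscale z v) = fscale z (T v)"
  shows "flinear T"
  using assms
  by (simp add: Vector_Spaces.linear_def module_hom_def module_hom_axioms_def vector_space_fscale
      fock.vs1.module_axioms)

lemma flinearD:
  assumes "flinear T"
  shows "T (v + w) = T v + T w" "T (fscale z v) = fscale z (T v)" "T 0 = 0"
    "T (v - w) = T v - T w" "T (- v) = - T v"
  using assms by (simp_all add: fock.linear_add fock.linear_scale fock.linear_0 fock.linear_diff
      fock.linear_neg)

lemma fscale_mult_left: "fscale z p * q = fscale z (p * q)" "p * fscale z q = fscale z (p * q)"
  by (simp_all add: fscale_def mult_ac)

lemma flinear_fscale: "flinear (fscale z)"
  by (rule flinearI) (simp_all add: fscale_simps mult.commute)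

lemma flinear_Sum_any:
  assumes "flinear T" "finite {m. f m \<noteq> 0}"
  shows "T (Sum_any f) = Sum_any (\<lambda>m. T (f m))"
proof -
  have "{m. T (f m) \<noteq> 0} \<subseteq> {m. f m \<noteq> 0}" using flinearD(3)[OF assms(1)] by auto
  then show ?thesis using assms
    by (simp add: Sum_any.expand_superset[OF assms(2)] fock.linear_sum)
qed

lemma flinear_Sum_any_op:
  assumes lin: "\<And>m. flinear (\<lambda>v. f m v)" and fin: "\<And>v. finite {m. f m v \<noteq> 0}"
  shows "flinear (\<lambda>v. Sum_any (\<lambda>m. f m v))"
proof (rule flinearI)
  show "Sum_any (\<lambda>m. f m (v + w)) = Sum_any (\<lambda>m. f m v) + Sum_any (\<lambda>m. f m w)" for v w
    by (simp add: flinearD(1)[OF lin] Sum_any.distrib fin)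
  show "Sum_any (\<lambda>m. f m (fscale z v)) = fscale z (Sum_any (\<lambda>m. f m v))" for z v
    by (simp add: flinearD(2)[OF lin] fin
        flinear_Sum_any[OF flinear_fscale, where f = "\<lambda>m. f m v"])
qed

lemma Sum_any_fscale:
  "finite {m. f m \<noteq> 0} \<Longrightarrow> Sum_any (\<lambda>m. fscale z (f m)) = fscale z (Sum_any f)"
  by (rule flinear_Sum_any[OF flinear_fscale, symmetric])

lemma Sum_any_diff:
  assumes "finite {m. f m \<noteq> (0::fock)}" "finite {m. g m \<noteq> 0}"
  shows "Sum_any (\<lambda>m. f m - g m) = Sum_any f - Sum_any g"
proof -
  have "Sum_any (\<lambda>m. f m + (- g m)) = Sum_any f + Sum_any (\<lambda>m. - g m)"
    using assms by (intro Sum_any.distrib) simp_all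
  then show ?thesis
    by (simp add: Sum_any.expand_set sum_negf)
qed

lemma bij_reflect: "bij (\<lambda>p::int. n - p)"
  by (rule bij_betw_byWitness[where f' = "\<lambda>p. n - p"]) auto

lemma bij_shift: "bij (\<lambda>p::int. p + n)"
  by (rule bij_betw_byWitness[where f' = "\<lambda>p. p - n"]) auto

lemma Sum_any_shift:
  fixes f :: "nat \<Rightarrow> 'a::comm_monoid_add"
  assumes "finite {r. f r \<noteq> 0}" "f 0 = 0"
  shows "Sum_any f = Sum_any (\<lambda>r. f (Suc r))"
proof -
  obtain M where M: "{r. f r \<noteq> 0} \<subseteq> {..<M}"
    using assms(1) finite_nat_iff_bounded by blast
  then have "Sum_any f = sum f {..<Suc M}"
    by (intro Sum_any.expand_superset) auto
  also have "\<dots> = (\<Sum>r<M. f (Suc r))"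
    unfolding sum.lessThan_Suc_shift by (simp add: assms(2))
  also have "\<dots> = Sum_any (\<lambda>r. f (Suc r))"
    using M by (intro Sum_any.expand_superset[symmetric]) auto
  finally show ?thesis .
qed

lemma sum_odd_below:
  "(\<Sum>p\<in>{0<..<2 * int q}. if odd p then c else 0) = of_nat q * (c::complex)"
proof (induction q)
  case (Suc q)
  have "{0<..<2 * int (Suc q)} = (if q = 0 then {1} else insert (2 * int q) (insert (2 * int q + 1) {0<..<2 * int q}))"
    by auto
  then show ?case using Suc by (simp add: algebra_simps)
qed simp

section \<open>The grading by degree\<close>

definition homogeneous :: "int \<Rightarrow> fock set" where
  "homogeneous d = {p. \<forall>a\<in>Poly_Mapping.keys p. mono_deg a = d}"

lemma homogeneous_iff: "p \<in> homogeneous d \<longleftrightarrow> (\<forall>a. Poly_Mapping.lookup p a \<noteq> 0 \<longrightarrow> mono_deg a = d)"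
  by (auto simp: homogeneous_def in_keys_iff)

lemma lookup_fscale: "Poly_Mapping.lookup (fscale z p) a = z * Poly_Mapping.lookup p a"
proof (induction p rule: fock_induct)
  case (single b y)
  then show ?case by (simp add: fscale_def mult_single lookup_single when_def)
qed (simp_all add: fscale_simps lookup_add distrib_left)

lemma homogeneous_closed:
  "0 \<in> homogeneous d"
  "p \<in> homogeneous d \<Longrightarrow> q \<in> homogeneous d \<Longrightarrow> p + q \<in> homogeneous d"
  "p \<in> homogeneous d \<Longrightarrow> q \<in> homogeneous d \<Longrightarrow> p - q \<in> homogeneous d"
  "p \<in> homogeneous d \<Longrightarrow> fscale z p \<in> homogeneous d"
  unfolding homogeneous_iff lookup_add lookup_minus lookup_fscale
  by (simp, metis add_0, metis diff_self, metis mult_zero_right)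

lemma homogeneous_Sum_any:
  assumes "\<And>m. f m \<in> homogeneous d"
  shows "Sum_any f \<in> homogeneous d"
proof -
  have "sum f S \<in> homogeneous d" for S
    using assms by (induction S rule: infinite_finite_induct) (auto simp: homogeneous_closed)
  then show ?thesis by (simp add: Sum_any.expand_set)
qed

lemma homogeneous_single: "Poly_Mapping.single a z \<in> homogeneous (mono_deg a)"
  by (simp add: homogeneous_def)

lemma homogeneous_one: "1 \<in> homogeneous 0"
  using homogeneous_single[of 0 1] by (simp add: mono_deg_def)

lemma mono_deg_nonneg: "mono_deg a \<ge> 0"
  unfolding mono_deg_def
proof (rule sum_nonneg)
  fix v assume "v \<in> Poly_Mapping.keys a"
  show "0 \<le> int (Poly_Mapping.lookup a v) * - snd (Rep_creation v)"
    using Rep_creation[of v] by (intro mult_nonneg_nonneg) auto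
qed

lemma homogeneous_neg: "p \<in> homogeneous d \<Longrightarrow> d < 0 \<Longrightarrow> p = 0"
  using mono_deg_nonneg by (intro poly_mapping_eqI) (metis homogeneous_iff lookup_zero not_less)

lemma mono_deg_single: "mono_deg (Poly_Mapping.single v 1) = - snd (Rep_creation v)"
  by (simp add: mono_deg_def)

lemma monomial_split:
  assumes "Poly_Mapping.lookup a v \<noteq> (0::nat)"
  shows "a = Poly_Mapping.single v 1 + (a - Poly_Mapping.single v 1)"
  using assms by (intro poly_mapping_eqI) (auto simp: lookup_add lookup_minus lookup_single when_def)

text \<open>
  The Fock space is spanned by what the creation modes make out of the vacuum. This form of
  induction passes from operator identities on the vacuum to identities everywhere.
\<close>

lemma fock_monomial_induct [case_names one var scale add]:
  assumes one: "P 1" and var: "\<And>v p. P p \<Longrightarrow> P (fvar v * p)"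
    and scale: "\<And>z p. P p \<Longrightarrow> P (fscale z p)" and add: "\<And>p q. P p \<Longrightarrow> P q \<Longrightarrow> P (p + q)"
  shows "P p"
proof -
  have single: "P (Poly_Mapping.single a 1)" for a
  proof (induction "nat (mono_deg a)" arbitrary: a rule: less_induct)
    case less
    show ?case
    proof (cases "a = 0")
      case False
      then obtain v where "Poly_Mapping.lookup a v \<noteq> 0"
        by (metis poly_mapping_eqI lookup_zero)
      then have split: "a = Poly_Mapping.single v 1 + (a - Poly_Mapping.single v 1)"
        by (rule monomial_split)
      let ?b = "a - Poly_Mapping.single v 1"
      have "mono_deg a = - snd (Rep_creation v) + mono_deg ?b"
        using split mono_deg_add mono_deg_single by metis
      moreover have "snd (Rep_creation v) < 0" using Rep_creation[of v] by auto
      ultimately have "nat (mono_deg ?b) < nat (mono_deg a)"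
        using mono_deg_nonneg[of ?b] by linarith
      from var[OF less[OF this], of v] show ?thesis
        using split by (simp add: fvar_def mult_single)
    qed (use one in simp)
  qed
  show ?thesis
  proof (induction p rule: fock_induct)
    case zero
    show ?case using scale[OF one, of 0] by (simp add: fscale_simps)
  next
    case (single a z)
    show ?case using scale[OF \<open>P (Poly_Mapping.single a 1)\<close>, of z]
      by (simp add: fscale_def mult_single)
  qed (rule add)
qed

lemma lookup_fderiv:
  "Poly_Mapping.lookup (fderiv v p) a =
     of_nat (Poly_Mapping.lookup a v + 1) * Poly_Mapping.lookup p (a + Poly_Mapping.single v 1)"
proof (induction p rule: fock_induct)
  case (single b z)
  have "b - Poly_Mapping.single v 1 = a \<longleftrightarrow> b = a + Poly_Mapping.single v 1"
    if "Poly_Mapping.lookup b v \<noteq> 0"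
    using monomial_split[OF that] by (metis add.commute add_diff_cancel_right')
  then show ?case
    by (cases "Poly_Mapping.lookup b v = 0")
       (auto simp: fderiv_single lookup_single when_def lookup_add)
qed (simp_all add: fderiv_add lookup_add distrib_left)

text \<open>
  A monomial of degree $d \neq 0$ contains some variable, and the derivative by that variable
  does not lose its coefficient.
\<close>

lemma homogeneous_fderiv_zero:
  assumes "p \<in> homogeneous d" "d \<noteq> 0" "\<And>v. fderiv v p = 0"
  shows "p = 0"
proof (rule poly_mapping_eqI, rule ccontr)
  fix a assume a: "Poly_Mapping.lookup p a \<noteq> Poly_Mapping.lookup 0 a"
  with assms(1) have "mono_deg a = d" by (simp add: homogeneous_iff)
  with assms(2) have "a \<noteq> 0" by (auto simp: mono_deg_def)
  then obtain v where v: "Poly_Mapping.lookup a v \<noteq> 0"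
    by (metis poly_mapping_eqI lookup_zero)
  have "Poly_Mapping.lookup (fderiv v p) (a - Poly_Mapping.single v 1) \<noteq> 0"
    using a monomial_split[OF v] by (simp add: lookup_fderiv add.commute del: of_nat_add of_nat_Suc)
  with assms(3) show False by simp
qed

text \<open>
  Homogeneous vectors are eigenvectors of the grading operator, so that the commutator of the
  grading operator with a mode decides how the mode changes the degree.
\<close>

lemma homogeneous_iff_grading:
  "p \<in> homogeneous d \<longleftrightarrow> grading j k p = fscale ((2 * j\<^sup>2 + k) / (4 * (k + 2)) + of_int d) p"
proof -
  have "Poly_Mapping.lookup (grading j k p) a
    = ((2 * j\<^sup>2 + k) / (4 * (k + 2)) + of_int (mono_deg a)) * Poly_Mapping.lookup p a" for p a
  proof (induction p rule: fock_induct)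
    case (single b z)
    then show ?case by (simp add: grading_single lookup_single when_def)
  qed (simp_all add: grading_add lookup_add distrib_left, simp add: grading_def)
  then show ?thesis
    by (auto simp: poly_mapping_eq_iff fun_eq_iff lookup_fscale homogeneous_iff)
qed

lemma flinear_grading: "flinear (grading j k)"
proof (rule flinearI)
  show "grading j k (fscale z p) = fscale z (grading j k p)" for z p
  proof (induction p rule: fock_induct)
    case (single b y)
    then show ?case by (simp add: grading_single fscale_def mult_single mult_ac)
  qed (simp_all add: grading_add fscale_simps, simp add: grading_def)
qed (rule grading_add)

text \<open>
  Operators of weight \<open>n\<close> lower the degree by \<open>n\<close>, as the coefficient of $\zeta^{-n}$ in a field does.
\<close>

definition graded_op :: "int \<Rightarrow> (fock \<Rightarrow> fock) \<Rightarrow> bool" where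
  "graded_op n T \<longleftrightarrow> flinear T \<and> (\<forall>d. \<forall>v\<in>homogeneous d. T v \<in> homogeneous (d - n))"

abbreviation graded_series :: "field_op \<Rightarrow> bool" where
  "graded_series A \<equiv> \<forall>n. graded_op n (A n)"

lemma graded_op_linear: "graded_op n T \<Longrightarrow> flinear T"
  and graded_op_homogeneous: "graded_op n T \<Longrightarrow> v \<in> homogeneous d \<Longrightarrow> T v \<in> homogeneous (d - n)"
  by (auto simp: graded_op_def)

lemma graded_op_comp:
  assumes "graded_op m S" "graded_op n T"
  shows "graded_op (m + n) (\<lambda>v. S (T v))"
proof -
  have "S (T v) \<in> homogeneous (d - (m + n))" if "v \<in> homogeneous d" for v d
    using graded_op_homogeneous[OF assms(1) graded_op_homogeneous[OF assms(2) that]]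
    by (simp add: algebra_simps)
  moreover have "flinear (\<lambda>v. S (T v))"
    using assms[THEN graded_op_linear] by (intro flinearI) (simp_all add: flinearD)
  ultimately show ?thesis by (simp add: graded_op_def)
qed

lemma graded_op_zero: "graded_op n (\<lambda>v. 0)"
  by (simp add: graded_op_def homogeneous_closed fock.linear_zero)

lemma graded_op_add:
  "graded_op n S \<Longrightarrow> graded_op n T \<Longrightarrow> graded_op n (\<lambda>v. S v + T v)"
  "graded_op n S \<Longrightarrow> graded_op n T \<Longrightarrow> graded_op n (\<lambda>v. S v - T v)"
  "graded_op n S \<Longrightarrow> graded_op n (\<lambda>v. fscale z (S v))"
  by (auto simp: graded_op_def homogeneous_closed fock.linear_compose_add fock.linear_compose_sub
      fock.linear_compose_scale_right)

lemma graded_op_id: "graded_op 0 (\<lambda>v. v)"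
  by (auto simp: graded_op_def fock.vs1.linear_id intro!: flinearI)

lemma graded_op_Sum_any:
  assumes "\<And>m. graded_op n (f m)" "\<And>v. finite {m. f m v \<noteq> 0}"
  shows "graded_op n (\<lambda>v. Sum_any (\<lambda>m. f m v))"
  using assms unfolding graded_op_def
  by (auto intro!: flinear_Sum_any_op homogeneous_Sum_any)

text \<open>
  Degrees are nonnegative. This is the source of local finiteness of products of fields: on a
  given vector only the modes up to some index can be nonzero.
\<close>

lemma graded_series_vanish:
  assumes "graded_series A"
  shows "\<exists>N. \<forall>n>N. A n v = 0"
proof (induction v rule: fock_induct)
  case zero
  show ?case using assms by (simp add: graded_op_def flinearD(3))
next
  case (single a z)
  show ?case using graded_op_homogeneous[OF spec[OF assms] homogeneous_single]
    by (intro exI[of _ "mono_deg a"]) (metis diff_less_0_iff_less homogeneous_neg)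
next
  case (add p q)
  then obtain M N where "\<forall>n>M. A n p = 0" "\<forall>n>N. A n q = 0" by blast
  then show ?case using assms
    by (intro exI[of _ "max M N"]) (simp add: graded_op_def flinearD(1))
qed

lemma graded_op_phi: "graded_op n (phi j k i n)"
proof -
  have "flinear (phi j k i n)"
    by (rule flinearI)
       (simp_all add: phi_def fderiv_add fderiv_fscale fscale_simps fscale_mult_left algebra_simps)
  moreover have "phi j k i n v \<in> homogeneous (d - n)" if "v \<in> homogeneous d" for v d
  proof -
    have "grading j k (phi j k i n v) = phi j k i n (grading j k v) + fscale (- of_int n) (phi j k i n v)"
      using grading_phi[of j k i n v] by (simp add: algebra_simps)
    with that \<open>flinear (phi j k i n)\<close> show ?thesis
      by (simp add: homogeneous_iff_grading[of _ _ j k] flinearD fock.vs1.scale_left_distrib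
          fock.vs1.scale_left_diff_distrib algebra_simps)
  qed
  ultimately show ?thesis by (simp add: graded_op_def)
qed

lemma graded_op_grading:
  assumes T: "graded_op n T"
  shows "grading j k (T v) = T (grading j k v) - fscale (of_int n) (T v)"
proof -
  note lin = flinearD[OF graded_op_linear[OF T]]
  show ?thesis
  proof (induction v rule: fock_induct)
    case zero
    then show ?case by (simp add: lin grading_def)
  next
    case (single a z)
    note hom = homogeneous_single[of a z]
    have "grading j k (T (Poly_Mapping.single a z)) =
      fscale ((2 * j\<^sup>2 + k) / (4 * (k + 2)) + of_int (mono_deg a - n)) (T (Poly_Mapping.single a z))"
      using graded_op_homogeneous[OF T hom] homogeneous_iff_grading by blast
    moreover have "grading j k (Poly_Mapping.single a z) =
      fscale ((2 * j\<^sup>2 + k) / (4 * (k + 2)) + of_int (mono_deg a)) (Poly_Mapping.single a z)"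
      using hom homogeneous_iff_grading by blast
    ultimately show ?case
      by (simp add: lin fock.vs1.scale_left_distrib fock.vs1.scale_left_diff_distrib)
  qed (simp add: lin grading_add fscale_simps)
qed

section \<open>Uniqueness of families of graded operators\<close>

text \<open>
  As $k \neq 0, -2$, every annihilation mode is a nonzero multiple of a partial derivative.
\<close>

lemma phi_vanish:
  assumes "k \<noteq> 0" "k \<noteq> -2" "p \<in> homogeneous d" "d \<noteq> 0"
    and phi: "\<And>l n. is_mode l n \<Longrightarrow> 0 < n \<Longrightarrow> phi j k l n p = 0"
  shows "p = 0"
proof (rule homogeneous_fderiv_zero[OF assms(3,4)])
  fix v
  obtain i m where im: "Rep_creation v = (i, m)" by fastforce
  then have v: "v = Abs_creation (i, m)" "is_mode i m" "m < 0"
    using Rep_creation[of v] Rep_creation_inverse[of v] by auto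
  have mode: "is_mode i (- m)" using v by (simp add: is_mode_def)
  have "kappa k i * of_int (- m) \<noteq> 0"
    using assms(1,2) v(3) by (auto simp: kappa_def add_eq_0_iff2)
  then show "fderiv v p = 0"
    using phi[OF mode] v mode by (simp add: phi_def)
qed

lemma fvar_eq_phi:
  obtains i m where "is_mode i m" "m < 0" "\<And>p. fvar v * p = phi j k i m p"
proof -
  obtain i m where im: "Rep_creation v = (i, m)" by fastforce
  then have v: "v = Abs_creation (i, m)" "is_mode i m" "m < 0"
    using Rep_creation[of v] Rep_creation_inverse[of v] by auto
  with that show thesis by (simp add: phi_def)
qed

text \<open>
  The hypothesis \<open>comm\<close> is what a formula expressing $[\phi_{l,n}, R_i]$ through operators
  $R_{i'}$ of weight \<open>wt i + n\<close> amounts to. On the vacuum, vectors of negative degree vanish,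
  degree zero is the hypothesis \<open>vacuum\<close>, and positive degrees follow by induction: applying
  $\phi_{l,n}$ with $n > 0$ leads to operators that are known to kill the vacuum, so
  \<open>phi_vanish\<close> applies. Then \<open>comm\<close> with $n < 0$ moves $R_i$ past the creation modes.
\<close>

lemma graded_operators_zero:
  fixes R :: "'i \<Rightarrow> fock \<Rightarrow> fock"
  assumes k: "k \<noteq> 0" "k \<noteq> -2"
    and graded: "\<And>i. graded_op (wt i) (R i)"
    and comm: "\<And>i l n v. is_mode l n \<Longrightarrow> (\<And>i'. wt i' = wt i + n \<Longrightarrow> R i' v = 0) \<Longrightarrow>
      phi j k l n (R i v) = R i (phi j k l n v)"
    and vacuum: "\<And>i. wt i = 0 \<Longrightarrow> R i 1 = 0"
  shows "R i v = 0"
proof -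
  have hom: "R i 1 \<in> homogeneous (- wt i)" for i
    using graded_op_homogeneous[OF graded homogeneous_one] by simp
  have lin: "flinear (R i)" for i using graded by (rule graded_op_linear)
  have vac: "R i 1 = 0" for i
  proof (induction "nat (- wt i)" arbitrary: i rule: less_induct)
    case less
    consider "wt i > 0" | "wt i = 0" | "wt i < 0" by linarith
    then show ?case
    proof cases
      case 1
      then show ?thesis using homogeneous_neg[OF hom] by simp
    next
      case 2
      then show ?thesis by (rule vacuum)
    next
      case 3
      have "phi j k l n (R i 1) = 0" if "is_mode l n" "0 < n" for l n
      proof -
        have "phi j k l n (R i 1) = R i (phi j k l n 1)"
          using less 3 that by (intro comm) auto
        then show ?thesis using phi_vacuum(1)[OF that(2)] flinearD(3)[OF lin] by simp
      qed
      then show ?thesis using 3 by (intro phi_vanish[OF k hom]) auto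
    qed
  qed
  show ?thesis
  proof (induction v arbitrary: i rule: fock_monomial_induct)
    case (var v p)
    obtain l m where lm: "is_mode l m" "\<And>p. fvar v * p = phi j k l m p"
      using fvar_eq_phi[of v j k] by metis
    have "R i (phi j k l m p) = phi j k l m (R i p)"
      using comm[OF lm(1), of i p] var by simp
    then show ?case
      using var flinearD(3)[OF graded_op_linear[OF graded_op_phi]] by (simp add: lm(2))
  qed (simp_all add: vac flinearD[OF lin])
qed

section \<open>Exponentials of one-sided series\<close>

lemma graded_series_mult:
  assumes "graded_series A" "graded_series B" "\<And>n v. finite {m. A m (B (n - m) v) \<noteq> 0}"
  shows "graded_series (series_mult A B)"
proof
  fix n
  have "graded_op n (\<lambda>v. A m (B (n - m) v))" for m
    using graded_op_comp[of m "A m" "n - m" "B (n - m)"] assms by simp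
  then show "graded_op n (series_mult A B n)"
    unfolding series_mult_def using assms(3) by (intro graded_op_Sum_any)
qed

text \<open>
  The Leibniz rule for $[T, \cdot\,]$ on a product of two series. Separate finiteness of the two
  resulting sums is needed because \<open>Sum_any\<close> is additive only for finite supports.
\<close>

lemma series_mult_commutator:
  assumes T: "flinear T" and A: "\<And>m. flinear (A m)"
    and fin: "\<And>v. finite {m. A m (B (n - m) v) \<noteq> 0}"
      "finite {m. A' m (B (n - m) v) \<noteq> 0}" "finite {m. A m (B' (n - m) v) \<noteq> 0}"
    and TA: "\<And>m v. T (A m v) = A m (T v) + A' m v"
    and TB: "\<And>m. T (B m v) = B m (T v) + B' m v"
  shows "T (series_mult A B n v) =
    series_mult A B n (T v) + (series_mult A' B n v + series_mult A B' n v)"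
proof -
  have fin': "finite {m. A' m (B (n - m) v) + A m (B' (n - m) v) \<noteq> 0}"
    by (rule finite_subset[OF _ finite_UnI[OF fin(2,3)]]) auto
  have "T (series_mult A B n v) = Sum_any (\<lambda>m. T (A m (B (n - m) v)))"
    unfolding series_mult_def by (rule flinear_Sum_any[OF T fin(1)])
  also have "\<dots> = Sum_any (\<lambda>m. A m (B (n - m) (T v)) +
      (A' m (B (n - m) v) + A m (B' (n - m) v)))"
    by (simp add: TA TB flinearD[OF A] add_ac)
  finally show ?thesis
    by (simp add: series_mult_def Sum_any.distrib fin fin')
qed

text \<open>
  The sign \<open>s\<close> selects the side, so that $e^{X_-}$ and $e^{X_+}$ can be treated together. The index
  \<open>0\<close> belongs to neither side, which makes each coefficient of the exponential a finite sum.
\<close>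

definition one_sided :: "int \<Rightarrow> field_op \<Rightarrow> bool" where
  "one_sided s A \<longleftrightarrow> \<bar>s\<bar> = 1 \<and> (\<forall>n. s * n \<le> 0 \<longrightarrow> A n = (\<lambda>v. 0))"

lemma finite_one_sided: "\<bar>s\<bar> = (1::int) \<Longrightarrow> finite {m. 0 \<le> s * m \<and> 0 \<le> s * (n - m)}"
proof (rule finite_subset)
  assume "\<bar>s\<bar> = 1"
  then consider "s = 1" | "s = - 1" by linarith
  then show "{m. 0 \<le> s * m \<and> 0 \<le> s * (n - m)} \<subseteq> {-\<bar>n\<bar>..\<bar>n\<bar>}"
    by cases auto
qed simp

lemma finite_one_sided_mult:
  assumes "one_sided s A" "\<And>n v. s * n < 0 \<Longrightarrow> B n v = 0" "\<And>m. A m 0 = 0"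
  shows "finite {m. A m (B (n - m) v) \<noteq> 0}"
proof (rule finite_subset)
  show "finite {m. 0 \<le> s * m \<and> 0 \<le> s * (n - m)}"
    using assms(1) by (intro finite_one_sided) (simp add: one_sided_def)
  show "{m. A m (B (n - m) v) \<noteq> 0} \<subseteq> {m. 0 \<le> s * m \<and> 0 \<le> s * (n - m)}"
  proof (intro subsetI CollectI)
    fix m assume m: "m \<in> {m. A m (B (n - m) v) \<noteq> 0}"
    then have "\<not> s * m \<le> 0" using assms(1) by (auto simp: one_sided_def)
    moreover have "\<not> s * (n - m) < 0" using m assms(2,3) by force
    ultimately show "0 \<le> s * m \<and> 0 \<le> s * (n - m)" by linarith
  qed
qed

lemma series_power_simps:
  "series_power A 0 = series_one" "series_power A (Suc r) = series_mult A (series_power A r)"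
  by (simp_all add: series_power_def)

lemma series_power_one_sided:
  assumes A: "one_sided s A" "graded_series A" and n: "s * n < int r"
  shows "series_power A r n v = 0"
  using n
proof (induction r arbitrary: n v)
  case 0
  then show ?case by (auto simp: series_power_simps series_one_def)
next
  case (Suc r)
  have "A m (series_power A r (n - m) v) = 0" for m
  proof (cases "s * m \<le> 0")
    case True
    then show ?thesis using A by (simp add: one_sided_def)
  next
    case False
    then have "s * (n - m) < int r" using Suc.prems by (simp add: algebra_simps)
    then show ?thesis using Suc.IH A(2) by (simp add: graded_op_def flinearD(3))
  qed
  then show ?case by (simp add: series_power_simps series_mult_def)
qed

lemma finite_series_power:
  assumes A: "one_sided s A" "graded_series A"
  shows "finite {m. A m (series_power A r (n - m) v) \<noteq> 0}"
  using A by (intro finite_one_sided_mult)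
    (auto intro: series_power_one_sided simp: graded_op_def flinearD(3))

lemma graded_series_power:
  assumes A: "one_sided s A" "graded_series A"
  shows "graded_series (series_power A r)"
proof (induction r)
  case 0
  show ?case
  proof
    show "graded_op n (series_power A 0 n)" for n
      unfolding series_power_simps series_one_def using graded_op_zero[of n]
      by (cases "n = 0") (simp_all add: graded_op_id)
  qed
next
  case (Suc r)
  then show ?case unfolding series_power_simps
    using A finite_series_power[OF A] by (intro graded_series_mult)
qed

text \<open>
  If $[T, A(\zeta)] = c\,\zeta^{-p}$ is a scalar, then $[T, A(\zeta)^r] = r c\,\zeta^{-p} A(\zeta)^{r-1}$.
  For \<open>r = 0\<close> the factor \<open>r\<close> makes the truncated exponent \<open>r - 1\<close> harmless.
\<close>

lemma series_power_commutator:
  assumes A: "one_sided s A" "graded_series A" and T: "flinear T"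
    and TA: "\<And>m v. T (A m v) = A m (T v) + (if m = p then fscale c v else 0)"
  shows "T (series_power A r n v) =
    series_power A r n (T v) + fscale (c * of_nat r) (series_power A (r - 1) (n - p) v)"
proof (induction r arbitrary: n v)
  case 0
  then show ?case using T by (simp add: series_power_simps series_one_def flinearD fscale_simps)
next
  case (Suc r)
  define A' where "A' m v = (if m = p then fscale c v else 0)" for m v
  define B where "B = series_power A r"
  define B' where "B' m v = fscale (c * of_nat r) (series_power A (r - 1) (m - p) v)" for m v
  have lin: "flinear (A m)" for m using A by (simp add: graded_op_def)
  have AB': "A m (B' (n - m) v) = fscale (c * of_nat r) (A m (series_power A (r - 1) ((n - p) - m) v))"
    for m by (simp add: B'_def flinearD(2)[OF lin] algebra_simps)
  have fin: "finite {m. A m (series_power A (r - 1) ((n - p) - m) v) \<noteq> 0}"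
    by (rule finite_series_power[OF A])
  have "series_mult A B' n v = fscale (c * of_nat r) (series_power A r (n - p) v)"
  proof (cases r)
    case (Suc q)
    then show ?thesis using fin
      by (simp add: series_mult_def AB' flinear_Sum_any[OF flinear_fscale] series_power_simps)
  qed (simp add: series_mult_def AB' fscale_simps)
  moreover have "series_mult A' B n v = fscale c (B (n - p) v)"
    by (simp add: series_mult_def A'_def)
  moreover have "T (series_mult A B n v) =
      series_mult A B n (T v) + (series_mult A' B n v + series_mult A B' n v)"
  proof (rule series_mult_commutator[OF T lin])
    show "finite {m. A m (B (n - m) v) \<noteq> 0}" for v unfolding B_def by (rule finite_series_power[OF A])
    show "finite {m. A' m (B (n - m) v) \<noteq> 0}"
      by (rule finite_subset[of _ "{p}"]) (auto simp: A'_def)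
    show "finite {m. A m (B' (n - m) v) \<noteq> 0}"
      by (rule finite_subset[OF _ fin]) (auto simp: AB' fscale_simps)
    show "T (A m v) = A m (T v) + A' m v" for m v using TA by (simp add: A'_def)
    show "T (B m v) = B m (T v) + B' m v" for m using Suc.IH by (simp add: B_def B'_def)
  qed
  ultimately show ?case
    by (simp add: series_power_simps B_def algebra_simps)
qed

lemma finite_series_exp:
  assumes A: "one_sided s A" "graded_series A"
  shows "finite {r. fscale (f r) (series_power A r n v) \<noteq> 0}"
proof (rule finite_subset)
  show "{r. fscale (f r) (series_power A r n v) \<noteq> 0} \<subseteq> {..nat (s * n)}"
  proof
    fix r assume "r \<in> {r. fscale (f r) (series_power A r n v) \<noteq> 0}"
    then have "\<not> s * n < int r"
      using series_power_one_sided[OF A, of n r v] by (auto simp: fscale_simps)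
    then show "r \<in> {..nat (s * n)}" by simp
  qed
qed simp

lemma graded_series_exp:
  assumes A: "one_sided s A" "graded_series A"
  shows "graded_series (series_exp A)"
proof
  fix n
  have "graded_op n (\<lambda>v. fscale (1 / fact r) (series_power A r n v))" for r
    using graded_series_power[OF A, of r] by (intro graded_op_add(3)) simp
  then show "graded_op n (series_exp A n)"
    unfolding series_exp_def by (rule graded_op_Sum_any) (rule finite_series_exp[OF A])
qed

lemma series_exp_one_sided:
  assumes A: "one_sided s A" "graded_series A"
  shows "s * n < 0 \<Longrightarrow> series_exp A n v = 0"
  using series_power_one_sided[OF A, of n _ v]
  by (simp add: series_exp_def fscale_simps)

lemma series_exp_zero:
  assumes A: "one_sided s A" "graded_series A"
  shows "series_exp A 0 v = v"
proof -
  have "fscale (1 / fact r) (series_power A r 0 v) = (if r = 0 then v else 0)" for r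
    using series_power_one_sided[OF A, of 0 r v]
    by (cases r) (simp_all add: series_power_simps series_one_def fscale_simps)
  then show ?thesis by (simp add: series_exp_def)
qed

text \<open>
  The factor $r$ in \<open>series_power_commutator\<close> turns $1/r!$ into $1/(r-1)!$, so that the sum over $r$
  reproduces the exponential.
\<close>

lemma series_exp_commutator:
  assumes A: "one_sided s A" "graded_series A" and T: "flinear T"
    and TA: "\<And>m v. T (A m v) = A m (T v) + (if m = p then fscale c v else 0)"
  shows "T (series_exp A n v) = series_exp A n (T v) + fscale c (series_exp A (n - p) v)"
proof -
  note fin = finite_series_exp[OF A]
  define g where "g r = fscale (1 / fact r * (c * of_nat r)) (series_power A (r - 1) (n - p) v)" for r
  have g_Suc: "g (Suc r) = fscale (c / fact r) (series_power A r (n - p) v)" for r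
    by (simp add: g_def field_simps del: of_nat_Suc)
  have "finite {r. g (Suc r) \<noteq> 0}" unfolding g_Suc by (rule fin)
  moreover have "{r. g r \<noteq> 0} \<subseteq> insert 0 (Suc ` {r. g (Suc r) \<noteq> 0})"
  proof
    fix r assume "r \<in> {r. g r \<noteq> 0}"
    then show "r \<in> insert 0 (Suc ` {r. g (Suc r) \<noteq> 0})" by (cases r) auto
  qed
  ultimately have fin_g: "finite {r. g r \<noteq> 0}"
    by (meson finite.insertI finite_imageI finite_subset)
  have "T (series_exp A n v) = Sum_any (\<lambda>r. fscale (1 / fact r) (series_power A r n (T v)) + g r)"
    unfolding series_exp_def g_def
    by (simp add: flinear_Sum_any[OF T fin] flinearD[OF T] series_power_commutator[OF A T TA] fscale_simps)
  also have "\<dots> = series_exp A n (T v) + Sum_any g"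
    unfolding series_exp_def by (rule Sum_any.distrib[OF fin fin_g])
  also have "Sum_any g = Sum_any (\<lambda>r. fscale c (fscale (1 / fact r) (series_power A r (n - p) v)))"
    using Sum_any_shift[OF fin_g] by (simp add: g_Suc fscale_simps g_def[of 0])
  also have "\<dots> = fscale c (series_exp A (n - p) v)"
    unfolding series_exp_def by (rule flinear_Sum_any[OF flinear_fscale fin, symmetric])
  finally show ?thesis .
qed

section \<open>Normally ordered exponentials\<close>

context
  fixes X :: field_op
  assumes gradedX: "graded_series X" and X_zero: "X 0 = (\<lambda>v. 0)"
begin

lemma one_sided_creation: "one_sided (-1) (creation_part X)"
  by (auto simp: one_sided_def creation_part_def)

lemma one_sided_annihilation: "one_sided 1 (annihilation_part X)"
  by (auto simp: one_sided_def annihilation_part_def X_zero)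

lemma graded_creation: "graded_series (creation_part X)"
proof
  show "graded_op n (creation_part X n)" for n
    unfolding creation_part_def using gradedX graded_op_zero[of n]
    by (cases "n < 0") simp_all
qed

lemma graded_annihilation: "graded_series (annihilation_part X)"
proof
  show "graded_op n (annihilation_part X n)" for n
    unfolding annihilation_part_def using gradedX graded_op_zero[of n]
    by (cases "n \<ge> 0") simp_all
qed

lemmas exp_creation = graded_series_exp[OF one_sided_creation graded_creation]
lemmas exp_annihilation = graded_series_exp[OF one_sided_annihilation graded_annihilation]

lemma finite_normal_exp:
  "finite {m. series_exp (creation_part X) m (series_exp (annihilation_part X) (n - m) v) \<noteq> 0}"
proof -
  obtain N where N: "\<forall>m>N. series_exp (annihilation_part X) m v = 0"
    using graded_series_vanish[OF exp_annihilation] by blast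
  have "m \<in> {n - N..0}"
    if "series_exp (creation_part X) m (series_exp (annihilation_part X) (n - m) v) \<noteq> 0" for m
  proof -
    have "\<not> 0 < m"
      using that series_exp_one_sided[OF one_sided_creation graded_creation, of m] by auto
    moreover have "\<not> N < n - m"
      using that N exp_creation by (metis flinearD(3) graded_op_linear)
    ultimately show ?thesis by simp
  qed
  then show ?thesis by (rule_tac finite_subset[of _ "{n - N..0}"]) auto
qed

lemma graded_normal_exp: "graded_series (normal_exp X)"
  unfolding normal_exp_def
  by (rule graded_series_mult[OF exp_creation exp_annihilation finite_normal_exp])

lemma normal_exp_zero_vacuum: "normal_exp X 0 1 = 1"
proof -
  have *: "series_exp (annihilation_part X) m 1 = 0" if "m > 0" for m
    using graded_op_homogeneous[OF spec[OF exp_annihilation] homogeneous_one] that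
    by (metis diff_0 homogeneous_neg neg_less_0_iff_less)
  have "series_exp (creation_part X) m (series_exp (annihilation_part X) (0 - m) 1) =
     (if m = 0 then 1 else 0)" for m
  proof (cases m "0::int" rule: linorder_cases)
    case less
    then show ?thesis using *[of "0 - m"] flinearD(3)[OF graded_op_linear[OF spec[OF exp_creation]]]
      by simp
  next
    case equal
    then show ?thesis using series_exp_zero[OF one_sided_creation graded_creation]
        series_exp_zero[OF one_sided_annihilation graded_annihilation] by simp
  next
    case greater
    then show ?thesis using series_exp_one_sided[OF one_sided_creation graded_creation, of m] by simp
  qed
  then show ?thesis by (simp add: normal_exp_def series_mult_def)
qed

text \<open>
  A scalar commutator $c\,\zeta^{-p}$ with $X$ comes from only one of the two parts of $X$,
  depending on the sign of $p$. In both cases it yields $[T, {:}e^X{:}] = c\,\zeta^{-p}\,{:}e^X{:}$.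
\<close>

lemma normal_exp_commutator:
  assumes T: "flinear T"
    and TX: "\<And>m v. T (X m v) = X m (T v) + (if m = p then fscale c v else 0)"
  shows "T (normal_exp X n v) = normal_exp X n (T v) + fscale c (normal_exp X (n - p) v)"
proof -
  let ?C = "series_exp (creation_part X)" and ?A = "series_exp (annihilation_part X)"
  define c1 c2 where "c1 = (if p < 0 then c else 0)" and "c2 = (if p < 0 then 0 else c)"
  have C: "T (?C m v) = ?C m (T v) + fscale c1 (?C (m - p) v)" for m v
    by (rule series_exp_commutator[OF one_sided_creation graded_creation T])
       (auto simp: creation_part_def TX c1_def flinearD[OF T] fscale_simps)
  have A: "T (?A m v) = ?A m (T v) + fscale c2 (?A (m - p) v)" for m v
    by (rule series_exp_commutator[OF one_sided_annihilation graded_annihilation T])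
       (auto simp: annihilation_part_def TX c2_def flinearD[OF T] fscale_simps)
  have linC: "flinear (?C m)" for m using exp_creation by (simp add: graded_op_def)
  have shift: "bij (\<lambda>m::int. m - p)" by (rule bij_betw_byWitness[where f' = "\<lambda>m. m + p"]) auto
  have eqC: "fscale c1 (?C (m - p) (?A (n - m) v)) = fscale c1 (?C (m - p) (?A ((n - p) - (m - p)) v))"
    and eqA: "?C m (fscale c2 (?A (n - m - p) v)) = fscale c2 (?C m (?A ((n - p) - m) v))" for m
    by (simp_all add: flinearD(2)[OF linC] algebra_simps)
  have fin1: "finite {m. ?C (m - p) (?A ((n - p) - (m - p)) v) \<noteq> 0}"
    using finite_vimageI[OF finite_normal_exp[of "n - p" v] bij_is_inj[OF shift]]
    by (simp add: vimage_def)
  note fin2 = finite_normal_exp[of "n - p" v]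
  define C' where "C' m v = fscale c1 (?C (m - p) v)" for m v
  define A' where "A' m v = fscale c2 (?A (m - p) v)" for m v
  have finC: "finite {m. C' m (?A (n - m) v) \<noteq> 0}"
    by (rule finite_subset[OF _ fin1]) (auto simp: C'_def)
  have finA: "finite {m. ?C m (A' (n - m) v) \<noteq> 0}"
    by (rule finite_subset[OF _ fin2]) (auto simp: A'_def eqA)
  have "T (series_mult ?C ?A n v) = series_mult ?C ?A n (T v) +
      (series_mult C' ?A n v + series_mult ?C A' n v)"
    by (rule series_mult_commutator[where A = ?C and B = ?A and A' = C' and B' = A', OF T linC finite_normal_exp finC finA])
       (simp_all only: C'_def A'_def C A)
  also have "series_mult C' ?A n v = fscale c1 (normal_exp X (n - p) v)"
    unfolding normal_exp_def series_mult_def C'_def eqC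
    using Sum_any.reindex_cong[OF shift, of "\<lambda>m. ?C m (?A ((n - p) - m) v)"]
    by (simp only: flinear_Sum_any[OF flinear_fscale fin1, symmetric] comp_def)
  also have "series_mult ?C A' n v = fscale c2 (normal_exp X (n - p) v)"
    unfolding normal_exp_def series_mult_def A'_def eqA
    by (rule flinear_Sum_any[OF flinear_fscale fin2, symmetric])
  finally show ?thesis
    by (simp add: normal_exp_def c1_def c2_def fscale_simps)
qed

end

section \<open>The exponential factor of the current\<close>

text \<open>
  $[\phi_{l,r}, X(\zeta)] = \<open>charge l\<close>\,\zeta^r$ whenever the mode $\phi_{l,r}$ exists, with the $X$
  of the introduction.
\<close>

definition charge :: "nat \<Rightarrow> complex" where
  "charge l = (if l = 0 then 4 else if l = 1 then 0 else -4)"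

definition parity_sign :: "int \<Rightarrow> complex" where
  "parity_sign n = (if even n then 1 else -1)"

locale fock_level =
  fixes j k :: complex
  assumes k: "k \<noteq> 0" "k \<noteq> -2"
begin

definition exponent :: field_op where
  "exponent = series_add (series_scale (1/k) (phi_series j k 2)) (series_scale (1/k) (phi_series j k 0))"

definition vertex :: field_op where
  "vertex = normal_exp exponent"

definition boson :: field_op where
  "boson = series_add (Dphi1_series j k) (series_D (phi_series j k 2))"

definition current :: field_op where
  "current = normal_mult_exp boson exponent"

lemma phi_nonmode: "\<not> is_mode l n \<Longrightarrow> phi j k l n v = 0"
  by (simp add: phi_def)

lemmas flinear_phi = graded_op_linear[OF graded_op_phi]

lemma exponent_eq:
  "exponent n v = fscale (- 1 / (k * of_int n)) (phi j k 2 n v + phi j k 0 n v)"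
  by (simp add: exponent_def series_add_def series_scale_def phi_series_def fscale_simps)

lemma boson_eq: "boson n = phi j k (if even n then 1 else 2) n"
proof
  have "n = 0 \<Longrightarrow> phi j k 2 n v = 0" for v by (simp add: phi_nonmode is_mode_def)
  then show "boson n v = phi j k (if even n then 1 else 2) n v" for v
    by (auto simp: boson_def series_add_def Dphi1_series_def series_D_def phi_series_def
        phi_nonmode is_mode_def)
qed

lemma mode_boson_index: "is_mode (if even n then 1 else 2) n"
  by (simp add: is_mode_def)

lemma graded_exponent: "graded_series exponent"
  unfolding exponent_eq[abs_def] by (intro allI graded_op_add graded_op_phi)

lemma exponent_zero: "exponent 0 = (\<lambda>v. 0)"
  by (simp add: fun_eq_iff exponent_eq)

lemma graded_vertex: "graded_series vertex"
  unfolding vertex_def by (rule graded_normal_exp[OF graded_exponent exponent_zero])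

lemma graded_boson: "graded_series boson"
  by (simp add: boson_eq graded_op_phi)

lemmas flinear_vertex = graded_op_linear[OF spec[OF graded_vertex]]
lemmas flinear_boson = graded_op_linear[OF spec[OF graded_boson]]
lemmas vertexD = flinearD[OF flinear_vertex]
lemmas bosonD = flinearD[OF flinear_boson]
lemmas phiD = flinearD[OF flinear_phi]

lemma mode_exponent:
  assumes "is_mode l r"
  shows "phi j k l r (exponent m v) =
    exponent m (phi j k l r v) + (if m = - r then fscale (charge l) v else 0)"
proof (cases "even m")
  case True
  then show ?thesis using assms
    by (auto simp: exponent_eq phi_nonmode is_mode_def phiD charge_def)
next
  case False
  have "is_mode 2 m" "is_mode 0 m" using False by (simp_all add: is_mode_def)
  from this[THEN phi_commutator[OF assms], of j k v]
  have *: "phi j k l r (phi j k 2 m v) = phi j k 2 m (phi j k l r v) +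
      fscale (if l = 2 \<and> r + m = 0 then kappa k l * of_int r else 0) v"
    "phi j k l r (phi j k 0 m v) = phi j k 0 m (phi j k l r v) +
      fscale (if l = 0 \<and> r + m = 0 then kappa k l * of_int r else 0) v"
    by (simp_all add: algebra_simps)
  have "r \<noteq> 0" if "m = - r" using that False by auto
  then show ?thesis using assms k False
    by (auto simp: exponent_eq phiD * fscale_simps is_mode_def charge_def kappa_def
        fock.vs1.scale_left_distrib[symmetric])
qed

lemma mode_vertex:
  assumes "is_mode l r"
  shows "phi j k l r (vertex n v) = vertex n (phi j k l r v) + fscale (charge l) (vertex (n + r) v)"
  using normal_exp_commutator[OF graded_exponent exponent_zero flinear_phi mode_exponent[OF assms]]
  by (simp add: vertex_def)

text \<open>
  The contributions of $\phi_0$ and $\phi_2$ cancel because their charges are opposite.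
\<close>

lemma exponent_commute: "exponent p (exponent m v) = exponent m (exponent p v)"
proof (cases "odd p")
  case True
  then have modes: "is_mode 0 p" "is_mode 2 p" by (simp_all add: is_mode_def)
  show ?thesis
    unfolding exponent_eq[of p] mode_exponent[OF modes(1)] mode_exponent[OF modes(2)]
      flinearD[OF graded_op_linear[OF spec[OF graded_exponent]]]
    by (simp add: charge_def)
next
  case False
  then have "exponent p = (\<lambda>v. 0)"
    by (simp add: fun_eq_iff exponent_eq phi_nonmode is_mode_def)
  then show ?thesis
    by (simp add: flinearD[OF graded_op_linear[OF spec[OF graded_exponent]]])
qed

lemma exponent_vertex: "exponent p (vertex n v) = vertex n (exponent p v)"
  using normal_exp_commutator[OF graded_exponent exponent_zero
      graded_op_linear[OF spec[OF graded_exponent]], of p 0 0 n v] exponent_commute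
  by (simp add: vertex_def)

text \<open>
  The commutator lemma for exponentials is applied twice with $c = 0$: a mode of $X$ commutes with
  the modes of $X$, hence with $E_m$; therefore $E_m$ commutes with the modes of $X$, hence with $E_n$.
\<close>

lemma vertex_commute: "vertex m (vertex n v) = vertex n (vertex m v)"
  using normal_exp_commutator[OF graded_exponent exponent_zero flinear_vertex, of m 0 0 n v]
    exponent_vertex
  by (simp add: vertex_def)

lemma vertex_boson:
  "vertex n (boson p v) = boson p (vertex n v) + (if odd p then fscale 4 (vertex (n + p) v) else 0)"
  unfolding boson_eq mode_vertex[OF mode_boson_index] by (simp add: charge_def)

lemma finite_vertex_pairs: "finite {b. vertex (N - b) (vertex b v) \<noteq> 0}"
proof -
  obtain M where M: "\<forall>m>M. vertex m v = 0"
    using graded_series_vanish[OF graded_vertex] by blast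
  have "b \<in> {N - M..M}" if "vertex (N - b) (vertex b v) \<noteq> 0" for b
  proof -
    have "\<not> b > M" using that M vertexD(3) by metis
    moreover have "\<not> N - b > M" using that M vertexD(3) vertex_commute by metis
    ultimately show ?thesis by simp
  qed
  then have "{b. vertex (N - b) (vertex b v) \<noteq> 0} \<subseteq> {N - M..M}" by blast
  then show ?thesis by (rule finite_subset) simp
qed

text \<open>
  The coefficient of $\zeta^{-N}$ in $E(\zeta)E(-\zeta)$.
\<close>

definition signed_pairs :: field_op where
  "signed_pairs N v = Sum_any (\<lambda>b. fscale (parity_sign b) (vertex (N - b) (vertex b v)))"

lemma graded_signed_pairs: "graded_op N (signed_pairs N)"
proof -
  have "graded_op N (\<lambda>v. fscale (parity_sign b) (vertex (N - b) (vertex b v)))" for b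
    using graded_op_comp[OF spec[OF graded_vertex, of "N - b"] spec[OF graded_vertex, of b]]
    by (intro graded_op_add(3)) simp
  then show ?thesis unfolding signed_pairs_def[abs_def]
    by (intro graded_op_Sum_any) (auto intro: finite_subset[OF _ finite_vertex_pairs[of N]])
qed

text \<open>
  A mode $\phi_{l,r}$ with nonzero charge has odd $r$, so that the factors $\zeta^r$ and
  $(-\zeta)^r$ produced by $E(\zeta)$ and $E(-\zeta)$ cancel.
\<close>

lemma mode_signed_pairs:
  assumes lr: "is_mode l r"
  shows "phi j k l r (signed_pairs N v) = signed_pairs N (phi j k l r v)"
proof -
  let ?f = "\<lambda>N b v. fscale (parity_sign b) (vertex (N - b) (vertex b v))"
  have fin: "finite {b. ?f N b v \<noteq> 0}" for N v
    by (rule finite_subset[OF _ finite_vertex_pairs[of N v]]) auto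
  let ?g = "\<lambda>b. ?f (N + r) b v"
  have fin': "finite {b. ?g (b + r) \<noteq> 0}"
    using finite_vimageI[OF fin[of "N + r" v] bij_is_inj[OF bij_shift[of r]]] by (simp add: vimage_def)
  have cancel: "fscale (charge l) (fscale (parity_sign b) (vertex (N - b) (vertex (b + r) v)))
      = - fscale (charge l) (?g (b + r))" for b
    using lr by (auto simp: is_mode_def parity_sign_def charge_def)
  have summand: "phi j k l r (?f N b v) = ?f N b (phi j k l r v) +
      fscale (charge l) (?g b - ?g (b + r))" for b
    using cancel[of b]
    by (simp add: phiD mode_vertex[OF lr] vertexD fscale_simps mult.commute algebra_simps)
  have "Sum_any (\<lambda>b. ?g b - ?g (b + r)) = 0"
  proof -
    have "Sum_any ?g = Sum_any (\<lambda>b. ?g (b + r))"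
      by (rule Sum_any.reindex_cong[OF bij_shift[of r]]) (simp add: comp_def)
    then show ?thesis by (simp only: Sum_any_diff[OF fin fin'] diff_self)
  qed
  moreover have fin2: "finite {b. ?g b - ?g (b + r) \<noteq> 0}"
    by (rule finite_subset[OF _ finite_UnI[OF fin[of "N + r" v] fin']]) auto
  moreover have "finite {b. fscale (charge l) (?g b - ?g (b + r)) \<noteq> 0}"
    by (rule finite_subset[OF _ fin2]) auto
  ultimately show ?thesis
    unfolding signed_pairs_def flinear_Sum_any[OF flinear_phi fin] summand
    by (simp add: Sum_any.distrib[OF fin] Sum_any_fscale)
qed

lemma vertex_vacuum: "vertex n 1 = (if n = 0 then 1 else 0)" if "n \<ge> 0"
  using that graded_op_homogeneous[OF spec[OF graded_vertex] homogeneous_one, of n]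
    homogeneous_neg[of "vertex n 1" "0 - n"]
    normal_exp_zero_vacuum[OF graded_exponent exponent_zero]
  by (auto simp: vertex_def)

text \<open>
  One of $E_b$ and $E_{-b}$ kills the vacuum unless $b = 0$, and they commute.
\<close>

lemma vertex_pair_vacuum: "vertex (- b) (vertex b 1) = (if b = 0 then 1 else 0)"
  by (cases "b \<ge> 0") (use vertex_vacuum vertexD(3) vertex_commute in \<open>auto simp: vertex_commute[of "-b" b]\<close>)

text \<open>
  $E(\zeta)E(-\zeta) = 1$: all the modes commute with $E(\zeta)E(-\zeta) - 1$, so that it is enough
  to evaluate the constant term on the vacuum.
\<close>

lemma signed_pairs_eq: "signed_pairs N v = (if N = 0 then v else 0)"
proof -
  have "signed_pairs N v - (if N = 0 then v else 0) = 0"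
  proof (rule graded_operators_zero[where wt = id and j = j
        and R = "\<lambda>N v. signed_pairs N v - (if N = 0 then v else 0)", OF k])
    show "graded_op (id N) (\<lambda>v. signed_pairs N v - (if N = 0 then v else 0))" for N
      using graded_signed_pairs[of N] graded_op_id graded_op_zero[of N]
      by (cases "N = 0") (simp_all add: graded_op_add)
    show "phi j k l n (signed_pairs i v - (if i = 0 then v else 0)) =
       signed_pairs i (phi j k l n v) - (if i = 0 then phi j k l n v else 0)"
      if "is_mode l n" for i l n v
      by (simp add: phiD mode_signed_pairs[OF that])
    have "fscale (parity_sign b) (vertex (- b) (vertex b 1)) = (if b = 0 then 1 else 0)" for b
      by (simp add: vertex_pair_vacuum parity_sign_def)
    then show "signed_pairs N 1 - (if N = 0 then 1 else 0) = 0" if "id N = 0" for N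
      using that by (simp add: signed_pairs_def)
  qed
  then show ?thesis by simp
qed

text \<open>
  The part of the coefficient of $\zeta^{-N}$ in $E(\zeta)^2$ where the index of the second factor has a
  fixed parity. The commutator $[E_m, J_n]$ is a multiple of such a sum.
\<close>

definition parity_pairs :: "bool \<Rightarrow> field_op" where
  "parity_pairs e N v = Sum_any (\<lambda>b. if even b = e then vertex (N - b) (vertex b v) else 0)"

lemma finite_parity_pairs: "finite {b. (if even b = e then vertex (N - b) (vertex b v) else 0) \<noteq> 0}"
  by (rule finite_subset[OF _ finite_vertex_pairs[of N v]]) auto

lemma parity_pairs_diff:
  "parity_pairs True N v - parity_pairs False N v = (if N = 0 then v else 0)"
proof -
  have "parity_pairs True N v - parity_pairs False N v = signed_pairs N v"
    unfolding parity_pairs_def signed_pairs_def Sum_any_diff[OF finite_parity_pairs finite_parity_pairs, symmetric]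
    by (rule Sum_any.cong) (simp add: parity_sign_def)
  then show ?thesis by (simp add: signed_pairs_eq)
qed

lemma parity_pairs_vacuum: "parity_pairs e 0 1 = (if e then 1 else 0)"
proof -
  have "(if even b = e then vertex (0 - b) (vertex b 1) else 0) = (if b = 0 then if e then 1 else 0 else 0)" for b
    using vertex_pair_vacuum[of b] by auto
  then show ?thesis by (simp add: parity_pairs_def)
qed

section \<open>The current and its commutators with modes\<close>

definition ordered_term :: "int \<Rightarrow> int \<Rightarrow> fock \<Rightarrow> fock" where
  "ordered_term n p v = (if p < 0 then boson p (vertex (n - p) v) else vertex (n - p) (boson p v))"

lemma finite_ordered_terms: "finite {p. ordered_term n p v \<noteq> 0}"
proof -
  obtain M where M: "\<forall>m>M. boson m v = 0"
    using graded_series_vanish[OF graded_boson] by blast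
  obtain N where N: "\<forall>m>N. vertex m v = 0"
    using graded_series_vanish[OF graded_vertex] by blast
  have "p \<in> {min 0 (n - N)..max 0 M}" if "ordered_term n p v \<noteq> 0" for p
  proof (cases "p < 0")
    case True
    then have "\<not> N < n - p" using that N by (auto simp: ordered_term_def bosonD(3))
    then show ?thesis using True by simp
  next
    case False
    then have "\<not> M < p" using that M by (auto simp: ordered_term_def vertexD(3))
    then show ?thesis using False by simp
  qed
  then have "{p. ordered_term n p v \<noteq> 0} \<subseteq> {min 0 (n - N)..max 0 M}" by blast
  then show ?thesis by (rule finite_subset) simp
qed

text \<open>
  Both halves of the normally ordered product are indexed by the mode of $A$, so that commutators
  can be computed term by term in a single sum.
\<close>

lemma current_eq: "current n v = Sum_any (\<lambda>p. ordered_term n p v)"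
proof -
  let ?C = "\<lambda>p. if p < 0 then ordered_term n p v else 0"
  let ?A = "\<lambda>p. if p < 0 then 0 else ordered_term n p v"
  have fin: "finite {p. ?C p \<noteq> 0}" "finite {p. ?A p \<noteq> 0}"
    by (rule finite_subset[OF _ finite_ordered_terms[of n v]], auto)+
  have C: "series_mult (creation_part boson) vertex n v = Sum_any ?C"
    unfolding series_mult_def
    by (rule Sum_any.cong) (simp add: creation_part_def ordered_term_def)
  have "series_mult vertex (annihilation_part boson) n v = Sum_any (\<lambda>m. ?A (n - m))"
    unfolding series_mult_def
    by (rule Sum_any.cong) (auto simp: annihilation_part_def ordered_term_def vertexD(3))
  also have "\<dots> = Sum_any ?A"
    by (rule Sum_any.reindex_cong[OF bij_reflect[of n], symmetric]) (simp add: comp_def)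
  finally have A: "series_mult vertex (annihilation_part boson) n v = Sum_any ?A" .
  have "current n v = Sum_any ?C + Sum_any ?A"
    unfolding current_def normal_mult_exp_def vertex_def[symmetric] series_add_def C A ..
  also have "\<dots> = Sum_any (\<lambda>p. ?C p + ?A p)"
    by (rule Sum_any.distrib[OF fin, symmetric])
  also have "\<dots> = Sum_any (\<lambda>p. ordered_term n p v)"
    by (rule Sum_any.cong) simp
  finally show ?thesis .
qed

lemma graded_current: "graded_op n (current n)"
proof -
  have "graded_op n (ordered_term n p)" for p
    using graded_op_comp[OF spec[OF graded_boson, of p] spec[OF graded_vertex, of "n - p"]]
      graded_op_comp[OF spec[OF graded_vertex, of "n - p"] spec[OF graded_boson, of p]]
    by (cases "p < 0") (simp_all add: ordered_term_def[abs_def])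
  then show ?thesis
    unfolding current_eq[abs_def] by (rule graded_op_Sum_any) (rule finite_ordered_terms)
qed

lemmas currentD = flinearD[OF graded_op_linear[OF graded_current]]

text \<open>
  $[\phi_{l,r}, A_{-r}] = \<open>pairing l\<close> \cdot r$: the field $A$ contains $\phi_1$ and $\phi_2$, but not
  $\phi_0$.
\<close>

definition pairing :: "nat \<Rightarrow> complex" where
  "pairing l = (if l = 0 then 0 else kappa k l)"

lemma mode_boson:
  assumes lr: "is_mode l r"
  shows "phi j k l r (boson p v) =
    boson p (phi j k l r v) + (if p = - r then fscale (pairing l * of_int r) v else 0)"
  using phi_commutator[OF lr mode_boson_index[of p], of j k v] lr
  by (auto simp: boson_eq pairing_def is_mode_def algebra_simps split: if_splits)

text \<open>
  The Leibniz rule inside ${:}AE{:}$. The commutator with $A$ contributes only through one term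
  of the sum; the commutator with $E$ shifts every term in the same way.
\<close>

lemma mode_current:
  assumes lr: "is_mode l r"
  shows "phi j k l r (current n v) = current n (phi j k l r v) +
    fscale (pairing l * of_int r) (vertex (n + r) v) + fscale (charge l) (current (n + r) v)"
proof -
  let ?b = "\<lambda>p. if p = - r then fscale (pairing l * of_int r) (vertex (n + r) v) else 0"
  let ?c = "\<lambda>p. fscale (charge l) (ordered_term (n + r) p v)"
  have summand: "phi j k l r (ordered_term n p v) =
      ordered_term n p (phi j k l r v) + (?b p + ?c p)" for p
    by (auto simp: ordered_term_def mode_boson[OF lr] mode_vertex[OF lr] vertexD bosonD algebra_simps)
  have fin_b: "finite {p. ?b p \<noteq> 0}"
    by (rule finite_subset[of _ "{- r}"]) auto
  have fin_c: "finite {p. ?c p \<noteq> 0}"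
    by (rule finite_subset[OF _ finite_ordered_terms[of "n + r" v]]) auto
  have fin_bc: "finite {p. ?b p + ?c p \<noteq> 0}"
    by (rule finite_subset[OF _ finite_UnI[OF fin_b fin_c]]) auto
  have b: "Sum_any ?b = fscale (pairing l * of_int r) (vertex (n + r) v)"
    by (rule Sum_any.delta)
  have c: "Sum_any ?c = fscale (charge l) (current (n + r) v)"
    unfolding current_eq by (rule Sum_any_fscale[OF finite_ordered_terms])
  have "phi j k l r (current n v) =
      Sum_any (\<lambda>p. ordered_term n p (phi j k l r v) + (?b p + ?c p))"
    unfolding current_eq flinear_Sum_any[OF flinear_phi finite_ordered_terms] summand ..
  also have "\<dots> = current n (phi j k l r v) + (Sum_any ?b + Sum_any ?c)"
    unfolding Sum_any.distrib[OF finite_ordered_terms fin_bc] Sum_any.distrib[OF fin_b fin_c]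
    by (simp only: current_eq)
  finally show ?thesis unfolding b c by (simp only: add.assoc)
qed

text \<open>
  The factors $E$ commute, and $[E_m, A_p] = 4 E_{m+p}$ for odd $p$ only. In the sum of the products
  $E_{m+p} E_{n-p}$ that results, the second index has the parity opposite to $n$.
\<close>

lemma vertex_current:
  "vertex m (current n v) = current n (vertex m v) + fscale 4 (parity_pairs (odd n) (m + n) v)"
proof -
  let ?f = "\<lambda>b. if even b = odd n then vertex (m + n - b) (vertex b v) else 0"
  have summand: "vertex m (ordered_term n p v) = ordered_term n p (vertex m v) + fscale 4 (?f (n - p))" for p
    by (auto simp: ordered_term_def vertex_boson vertexD vertex_commute[of m "n - p"] algebra_simps
        intro: vertex_commute)
  have fin: "finite {p. ?f (n - p) \<noteq> 0}"
    using finite_vimageI[OF finite_parity_pairs[of "odd n" "m + n" v] bij_is_inj[OF bij_reflect[of n]]]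
    by (simp add: vimage_def)
  have fin4: "finite {p. fscale 4 (?f (n - p)) \<noteq> 0}"
    by (rule finite_subset[OF _ fin]) auto
  have "vertex m (current n v) = Sum_any (\<lambda>p. ordered_term n p (vertex m v) + fscale 4 (?f (n - p)))"
    unfolding current_eq flinear_Sum_any[OF flinear_vertex finite_ordered_terms] summand ..
  also have "\<dots> = current n (vertex m v) + fscale 4 (Sum_any (\<lambda>p. ?f (n - p)))"
    unfolding Sum_any.distrib[OF finite_ordered_terms fin4] Sum_any_fscale[OF fin] current_eq ..
  also have "Sum_any (\<lambda>p. ?f (n - p)) = parity_pairs (odd n) (m + n) v"
    unfolding parity_pairs_def
    by (rule Sum_any.reindex_cong[OF bij_reflect[of n], symmetric]) (simp add: comp_def)
  finally show ?thesis .
qed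

section \<open>The commutator of two modes of the current\<close>

lemma boson_vacuum: "p > 0 \<Longrightarrow> boson p 1 = 0" "boson 0 1 = fscale (2 * j) 1"
  by (simp_all add: boson_eq phi_vacuum del: One_nat_def)

lemma current_vacuum:
  "n > 0 \<Longrightarrow> current n 1 = 0" "current 0 1 = fscale (2 * j) 1"
proof -
  show "current n 1 = 0" if "n > 0"
    using graded_op_homogeneous[OF graded_current homogeneous_one] that
    by (metis diff_0 homogeneous_neg neg_less_0_iff_less)
  have "ordered_term 0 p 1 = (if p = 0 then fscale (2 * j) 1 else 0)" for p
    using vertex_vacuum[of 0] vertex_vacuum[of "- p"]
    by (cases p "0::int" rule: linorder_cases)
       (simp_all add: ordered_term_def boson_vacuum vertexD bosonD)
  then show "current 0 1 = fscale (2 * j) 1" by (simp add: current_eq)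
qed

lemma vertex_current_vacuum:
  "a > 0 \<Longrightarrow> vertex a (current (- a) 1) = (if odd a then fscale 4 1 else 0)"
  using vertex_current[of a "- a" 1] vertex_vacuum[of a]
  by (simp add: currentD parity_pairs_vacuum)

text \<open>
  In $J_m w = \sum_p {:}A_p E_{m-p}{:}\,w$ with $w = J_{-m}|j,k\rangle$ only $0 \le p \le m$ contribute,
  as $w$ has degree $m$. There $A_p$ is moved through $J_{-m}$ to the vacuum. The terms with the
  eigenvalue $2j$ of $\phi_{1,0}$, at $p = 0$ and $p = m$, cancel. For even $m$ the double
  contractions at the odd $p$ between them add up to $-8m$ and turn the level $4(k+2)m$
  of $\phi_1$ into $4km$.
\<close>

lemma current_current_vacuum_pos:
  assumes m: "m > 0"
  shows "current m (current (- m) 1) = fscale (4 * parity_sign m * k * of_int m) 1"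
proof -
  define w where "w = current (- m) 1"
  have w: "w \<in> homogeneous m"
    using graded_op_homogeneous[OF graded_current homogeneous_one, of "- m"] by (simp add: w_def)
  have out: "ordered_term m p w = 0" if "p < 0 \<or> m < p" for p
  proof (cases "p < 0")
    case True
    then have "vertex (m - p) w = 0"
      using homogeneous_neg graded_op_homogeneous[OF spec[OF graded_vertex] w, of "m - p"] by simp
    then show ?thesis using True by (simp add: ordered_term_def bosonD)
  next
    case False
    then have "boson p w = 0"
      using homogeneous_neg graded_op_homogeneous[OF spec[OF graded_boson] w, of p] that by simp
    then show ?thesis using False by (simp add: ordered_term_def vertexD)
  qed
  have bw: "boson p w = current (- m) (boson p 1) +
      fscale ((if even p then 4 * (k + 2) else - 4 * k) * of_int p) (vertex (p - m) 1) +
      fscale (if even p then 0 else -4) (current (p - m) 1)" for p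
    unfolding w_def boson_eq mode_current[OF mode_boson_index]
    by (auto simp: pairing_def kappa_def charge_def)
  \<comment> \<open>The value of the summand at \<open>p\<close>, as a multiple of the vacuum.\<close>
  define s where "s p = (if p = 0 then if odd m then 8 * j else 0
      else if p = m then if odd m then - 4 * k * of_int m - 8 * j else 4 * (k + 2) * of_int m
      else if odd p \<and> even m then -16 else 0)" for p
  have inside: "ordered_term m p w = fscale (s p) 1" if p: "p \<in> {0..m}" for p
  proof -
    consider "p = 0" | "0 < p" "p < m" | "p = m" using p by fastforce
    then show ?thesis
    proof cases
      case 1
      have "vertex m w = (if odd m then fscale 4 1 else 0)"
        unfolding w_def by (rule vertex_current_vacuum[OF m])
      then show ?thesis using 1 m
        by (simp add: ordered_term_def bw boson_vacuum currentD vertexD s_def w_def[symmetric])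
    next
      case 2
      then have "vertex (m - p) (current (p - m) 1) = (if odd (m - p) then fscale 4 1 else 0)"
        using vertex_current_vacuum[of "m - p"] by simp
      moreover have "vertex (m - p) (vertex (p - m) 1) = 0"
        using vertex_pair_vacuum[of "p - m"] 2 by simp
      ultimately show ?thesis using 2
        by (auto simp: ordered_term_def bw boson_vacuum currentD vertexD s_def)
    next
      case 3
      then show ?thesis using m vertex_vacuum[of 0]
        by (auto simp: ordered_term_def bw boson_vacuum currentD vertexD s_def current_vacuum
            fock.vs1.scale_left_distrib fock.vs1.scale_left_diff_distrib algebra_simps)
    qed
  qed
  have "current m w = (\<Sum>p\<in>{0..m}. ordered_term m p w)"
    unfolding current_eq using out by (intro Sum_any.expand_superset) force+
  also have "\<dots> = fscale (sum s {0..m}) 1"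
    by (simp add: inside fock.vs1.scale_sum_left)
  also have "sum s {0..m} = s 0 + s m + sum s {0<..<m}"
  proof -
    have "{0..m} = insert 0 (insert m {0<..<m})" using m by auto
    then show ?thesis using m by simp
  qed
  also have "\<dots> = 4 * parity_sign m * k * of_int m"
  proof (cases "even m")
    case True
    define q where "q = nat (m div 2)"
    have q: "m = 2 * int q" using True m by (simp add: q_def)
    have "sum s {0<..<m} = (\<Sum>p\<in>{0<..<2 * int q}. if odd p then -16 else 0)"
      unfolding q by (rule sum.cong) (auto simp: s_def q)
    also have "\<dots> = of_nat q * (- 16)" by (rule sum_odd_below)
    finally have "sum s {0<..<m} = of_nat q * (- 16)" .
    then show ?thesis using True m
      by (simp add: s_def parity_sign_def q algebra_simps)
  next
    case False
    then have "sum s {0<..<m} = 0" by (intro sum.neutral) (auto simp: s_def)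
    then show ?thesis using False m by (simp add: s_def parity_sign_def)
  qed
  finally show ?thesis by (simp add: w_def)
qed

text \<open>
  The difference $R_{m,n}$ between the two sides of the commutation relation for $J = 2x$.
\<close>

definition current_defect :: "int \<times> int \<Rightarrow> fock \<Rightarrow> fock" where
  "current_defect = (\<lambda>(m, n) v. current m (current n v) - current n (current m v) -
     fscale (4 * parity_sign m)
       ((if m + n = 0 then fscale (k * of_int m) v else 0) - phi j k 0 (m + n) v))"

lemma current_defect_vacuum: "current_defect (m, - m) 1 = 0"
proof -
  have phi0: "phi j k 0 0 v = 0" for v by (simp add: phi_nonmode is_mode_def)
  consider "m > 0" | "m = 0" | "m < 0" by linarith
  then show ?thesis
  proof cases
    case 1
    then show ?thesis using current_current_vacuum_pos[OF 1]
      by (simp add: current_defect_def phi0 current_vacuum currentD mult_ac)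
  next
    case 3
    then show ?thesis using current_current_vacuum_pos[of "- m"]
      by (simp add: current_defect_def phi0 current_vacuum currentD parity_sign_def mult_ac)
  qed (simp add: current_defect_def phi0)
qed

text \<open>
  The hypotheses allow $[J_{m+r}, J_n]$ and $[J_m, J_{n+r}]$ to be replaced by their expected values.
  What remains is that the scalar terms cancel. For $l = 1$ the index $r$ is even and
  $E(\zeta)E(-\zeta) = 1$ contributes nothing. For $l = 2$ its contribution cancels the central terms of
  these two brackets; for $l = 0$ the bracket with $\phi_{0,m+n}$ does.
\<close>

lemma mode_current_defect:
  assumes lr: "is_mode l r"
    and 0: "current_defect (m + r, n) v = 0" "current_defect (m, n + r) v = 0"
  shows "phi j k l r (current_defect (m, n) v) = current_defect (m, n) (phi j k l r v)"
proof -
  let ?T = "phi j k l r" and ?a = "pairing l * of_int r" and ?N = "m + n + r"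
  have P: "parity_pairs (odd n) ?N v - parity_pairs (odd m) ?N v =
      (if even (m + n) \<or> ?N \<noteq> 0 then 0 else fscale (parity_sign m) v)"
    using parity_pairs_diff[of ?N v]
    by (cases "even m"; cases "even n") (auto simp: parity_sign_def algebra_simps)
  have "?T (current m (current n v)) - ?T (current n (current m v)) -
      (current m (current n (?T v)) - current n (current m (?T v))) =
      fscale ?a (vertex (m + r) (current n v) - current n (vertex (m + r) v) -
        (vertex (n + r) (current m v) - current m (vertex (n + r) v))) +
      fscale (charge l) ((current (m + r) (current n v) - current n (current (m + r) v)) +
        (current m (current (n + r) v) - current (n + r) (current m v)))"
    by (simp add: mode_current[OF lr] currentD fscale_simps)
  also have "vertex (m + r) (current n v) - current n (vertex (m + r) v) -
        (vertex (n + r) (current m v) - current m (vertex (n + r) v)) =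
      fscale 4 (parity_pairs (odd n) ?N v - parity_pairs (odd m) ?N v)"
    by (simp add: vertex_current fscale_simps add_ac)
  also have "current (m + r) (current n v) - current n (current (m + r) v) =
      fscale (4 * parity_sign (m + r)) ((if ?N = 0 then fscale (k * of_int (m + r)) v else 0) -
        phi j k 0 ?N v)"
    using 0(1) by (simp add: current_defect_def algebra_simps)
  also have "current m (current (n + r) v) - current (n + r) (current m v) =
      fscale (4 * parity_sign m) ((if ?N = 0 then fscale (k * of_int m) v else 0) -
        phi j k 0 ?N v)"
    using 0(2) by (simp add: current_defect_def algebra_simps)
  also note P
  finally have main: "?T (current m (current n v)) - ?T (current n (current m v)) =
     (fscale ?a (fscale 4 (if even (m + n) \<or> ?N \<noteq> 0 then 0 else fscale (parity_sign m) v)) +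
      fscale (charge l)
       (fscale (4 * parity_sign (m + r)) ((if ?N = 0 then fscale (k * of_int (m + r)) v else 0) - phi j k 0 ?N v) +
        fscale (4 * parity_sign m) ((if ?N = 0 then fscale (k * of_int m) v else 0) - phi j k 0 ?N v))) +
      (current m (current n (?T v)) - current n (current m (?T v)))"
    by (rule iffD1[OF diff_eq_eq])
  have phi0: "?T (phi j k 0 (m + n) v) = phi j k 0 (m + n) (?T v) +
      (if l = 0 \<and> ?N = 0 then fscale (4 * k * of_int r) v else 0)"
  proof (cases "is_mode 0 (m + n)")
    case True
    then show ?thesis using phi_commutator[OF lr True, of j k v]
      by (auto simp: kappa_def algebra_simps)
  next
    case False
    then have "even (m + n)" by (simp add: is_mode_def)
    moreover have "odd r" if "l = 0" using lr that by (simp add: is_mode_def)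
    ultimately have "\<not> (l = 0 \<and> ?N = 0)" by presburger
    then show ?thesis using False by (auto simp: phi_nonmode phiD)
  qed
  have "?T (current_defect (m, n) v) - current_defect (m, n) (?T v) = 0"
  proof (cases "even r")
    case True
    then have l: "l = 1" using lr by (auto simp: is_mode_def)
    have "even (m + n) \<or> ?N \<noteq> 0" using True by presburger
    then have "?T (current m (current n v)) - ?T (current n (current m v)) =
       current m (current n (?T v)) - current n (current m (?T v))"
      using main by (simp add: l charge_def)
    moreover have "?T (phi j k 0 (m + n) v) = phi j k 0 (m + n) (?T v)" using phi0 l by simp
    ultimately show ?thesis by (simp add: current_defect_def phiD algebra_simps)
  next
    case False
    have sgn: "parity_sign (m + r) = - parity_sign m" using False by (simp add: parity_sign_def)
    have correction: "(fscale ?a (fscale 4 (if even (m + n) \<or> ?N \<noteq> 0 then 0 else fscale (parity_sign m) v)) +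
      fscale (charge l)
       (fscale (4 * parity_sign (m + r)) ((if ?N = 0 then fscale (k * of_int (m + r)) v else 0) - phi j k 0 ?N v) +
        fscale (4 * parity_sign m) ((if ?N = 0 then fscale (k * of_int m) v else 0) - phi j k 0 ?N v)))
      = fscale (- 4 * parity_sign m) (if l = 0 \<and> ?N = 0 then fscale (4 * k * of_int r) v else 0)"
    proof (cases "?N = 0")
      case True
      then have "even n \<longleftrightarrow> odd m" "r \<noteq> 0" using False by presburger+
      then show ?thesis using True False lr
        by (auto simp: is_mode_def charge_def pairing_def kappa_def sgn fscale_simps algebra_simps)
    qed (simp add: sgn fscale_simps)
    show ?thesis using main[unfolded correction]
      by (simp add: current_defect_def phiD phi0 fscale_simps algebra_simps)
  qed
  then show ?thesis by simp
qed

lemma graded_current_defect: "graded_op (m + n) (current_defect (m, n))"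
proof -
  have "graded_op (m + n) (\<lambda>v. if m + n = 0 then fscale (k * of_int m) v else 0)"
    using graded_op_add(3)[OF graded_op_id] graded_op_zero by (cases "m + n = 0") simp_all
  moreover have "graded_op (m + n) (\<lambda>v. current n (current m v))"
    using graded_op_comp[OF graded_current graded_current, of n m] by (simp add: add.commute)
  ultimately show ?thesis unfolding current_defect_def case_prod_conv
    using graded_op_comp[OF graded_current graded_current, of m n] by (intro graded_op_add graded_op_phi)
qed

theorem current_commutator:
  "current m (current n v) - current n (current m v) =
     fscale (4 * parity_sign m)
       ((if m + n = 0 then fscale (k * of_int m) v else 0) - phi j k 0 (m + n) v)"
proof -
  have "current_defect i v = 0" for i
  proof (rule graded_operators_zero[where wt = "\<lambda>(m, n). m + n" and R = current_defect and j = j, OF k])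
    show "graded_op (case i of (m, n) \<Rightarrow> m + n) (current_defect i)" for i
      by (cases i) (simp add: graded_current_defect)
    show "phi j k l r (current_defect i v) = current_defect i (phi j k l r v)"
      if "is_mode l r" and *: "\<And>i'. (case i' of (m, n) \<Rightarrow> m + n) = (case i of (m, n) \<Rightarrow> m + n) + r \<Longrightarrow>
        current_defect i' v = 0" for i l r v
    proof (cases i)
      case (Pair m n)
      then show ?thesis
        using mode_current_defect[OF \<open>is_mode l r\<close>, of m n v] *[of "(m + r, n)"] *[of "(m, n + r)"]
        by simp
    qed
    show "current_defect i 1 = 0" if "(case i of (m, n) \<Rightarrow> m + n) = 0" for i
      using that current_defect_vacuum[of "fst i"]
      by (cases i) (metis (no_types, lifting) add_eq_0_iff case_prod_conv fst_conv)
  qed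
  from this[of "(m, n)"] show ?thesis by (simp add: current_defect_def)
qed

end

section \<open>The representation\<close>

definition twisted :: "int \<Rightarrow> mat2 \<Rightarrow> bool" where
  "twisted m a \<longleftrightarrow> (even m \<longrightarrow> a $ 1 $ 2 = 0 \<and> a $ 2 $ 1 = 0 \<and> a $ 2 $ 2 = - a $ 1 $ 1) \<and>
    (odd m \<longrightarrow> a $ 1 $ 1 = 0 \<and> a $ 2 $ 2 = 0)"

lemma affine_sl2_twisted:
  "(u, r, s) \<in> affine_sl2 \<Longrightarrow> twisted m (Poly_Mapping.lookup u m)"
proof -
  assume "(u, r, s) \<in> affine_sl2"
  then have m: "even m \<Longrightarrow> \<exists>x. Poly_Mapping.lookup u m = mat_scale x sl2_h"
    "odd m \<Longrightarrow> \<exists>x y. Poly_Mapping.lookup u m = mat_scale x sl2_e + mat_scale y sl2_f"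
    by (auto simp: affine_sl2_def)
  show ?thesis
  proof (cases "even m")
    case True
    with m(1) show ?thesis by (auto simp: twisted_def mat_scale_def sl2_h_def)
  next
    case False
    with m(2) show ?thesis by (auto simp: twisted_def mat_scale_def sl2_e_def sl2_f_def)
  qed
qed

lemma mat_bracket_entries:
  "mat_bracket a b $ i $ l = (a $ i $ 1 * b $ 1 $ l + a $ i $ 2 * b $ 2 $ l)
     - (b $ i $ 1 * a $ 1 $ l + b $ i $ 2 * a $ 2 $ l)"
  by (simp add: mat_bracket_def matrix_matrix_mult_def sum_2)

lemma inv_form_entries:
  "inv_form a b = a $ 1 $ 1 * b $ 1 $ 1 + a $ 1 $ 2 * b $ 2 $ 1 + a $ 2 $ 1 * b $ 1 $ 2 + a $ 2 $ 2 * b $ 2 $ 2"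
  by (simp add: inv_form_def trace_def matrix_matrix_mult_def sum_2)

context fock_level
begin

text \<open>
  For odd \<open>m\<close>, $y e + z f = \frac{y+z}{2}(e + f) + \frac{z-y}{2}(-e + f)$. The further factors
  $\frac12$ come from $\beta = \frac12 D\phi_0$ and $x = \frac12 J$.
\<close>

definition mode_op :: "int \<Rightarrow> mat2 \<Rightarrow> fock \<Rightarrow> fock" where
  "mode_op m a v =
     (if even m then fscale (a $ 1 $ 1 / 2) (current m v)
      else fscale ((a $ 1 $ 2 + a $ 2 $ 1) / 4) (phi j k 0 m v) +
        fscale ((a $ 2 $ 1 - a $ 1 $ 2) / 4) (current m v))"

lemma mode_op_linear:
  "mode_op m (a + b) v = mode_op m a v + mode_op m b v"
  "mode_op m (mat_scale z a) v = fscale z (mode_op m a v)"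
  "mode_op m 0 v = 0"
  by (auto simp: mode_op_def mat_scale_def lookup_fscale lookup_add field_simps intro!: poly_mapping_eqI)

lemma graded_mode_op: "graded_op m (mode_op m a)"
  unfolding mode_op_def[abs_def] using graded_current[of m] graded_op_phi[of m j k 0]
  by (cases "even m") (simp_all add: graded_op_add)

lemma current_current:
  "current m (current n v) = current n (current m v) + fscale (4 * parity_sign m)
       ((if m + n = 0 then fscale (k * of_int m) v else 0) - phi j k 0 (m + n) v)"
  using current_commutator[of m n v] by (simp add: algebra_simps)

lemma phi_current:
  assumes "odd m"
  shows "phi j k 0 m (current n v) = current n (phi j k 0 m v) + fscale 4 (current (n + m) v)"
  using mode_current[of 0 m n v] assms by (simp add: is_mode_def pairing_def charge_def)

lemma phi_phi:
  assumes "odd m" "odd n"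
  shows "phi j k 0 m (phi j k 0 n v) = phi j k 0 n (phi j k 0 m v) +
    (if m + n = 0 then fscale (4 * k * of_int m) v else 0)"
  using phi_commutator[of 0 m 0 n j k v] assms by (auto simp: is_mode_def kappa_def algebra_simps)

text \<open>
  By the parities of \<open>m\<close> and \<open>n\<close>, the matrix bracket is compared with the brackets $[J, J]$,
  $[\phi_0, J]$ and $[\phi_0, \phi_0]$ of modes.
\<close>

lemma mode_op_commutator:
  assumes "twisted m a" "twisted n b"
  shows "mode_op m a (mode_op n b v) - mode_op n b (mode_op m a v) =
    mode_op (m + n) (mat_bracket a b) v +
    fscale (k * (if m + n = 0 then 1/2 * inv_form a b * of_int m else 0)) v"
\<comment> \<open>Passing to coefficients turns the identity into one of complex numbers.\<close>
proof (rule poly_mapping_eqI)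
  fix c
  have phi0: "phi j k 0 i w = 0" if "even i" for i w
    using that by (simp add: phi_nonmode is_mode_def)
  show "Poly_Mapping.lookup (mode_op m a (mode_op n b v) - mode_op n b (mode_op m a v)) c =
    Poly_Mapping.lookup (mode_op (m + n) (mat_bracket a b) v +
    fscale (k * (if m + n = 0 then 1/2 * inv_form a b * of_int m else 0)) v) c"
  proof (cases "even m"; cases "even n")
    assume "even m" "even n"
    then show ?thesis using assms
      by (simp add: mode_op_def current_current[of m n] phi0 currentD parity_sign_def twisted_def
          lookup_add lookup_minus lookup_fscale mat_bracket_entries inv_form_entries field_simps)
  next
    assume mn: "even m" "odd n"
    then have "m + n \<noteq> 0" by presburger
    then show ?thesis using assms mn
      by (simp add: mode_op_def current_current[of m n] phi_current[of n m] currentD phiD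
          parity_sign_def twisted_def add.commute[of n m]
          lookup_add lookup_minus lookup_fscale mat_bracket_entries inv_form_entries field_simps)
  next
    assume mn: "odd m" "even n"
    then have "m + n \<noteq> 0" by presburger
    then show ?thesis using assms mn
      by (simp add: mode_op_def current_current[of m n] phi_current[of m n] currentD phiD
          parity_sign_def twisted_def add.commute[of n m]
          lookup_add lookup_minus lookup_fscale mat_bracket_entries inv_form_entries field_simps)
  next
    assume mn: "odd m" "odd n"
    then show ?thesis using assms
      by (simp add: mode_op_def current_current[of m n] phi_current[of m n] phi_current[of n m]
          phi_phi[of m n] currentD phiD phi0
          parity_sign_def twisted_def add.commute[of n m]
          lookup_add lookup_minus lookup_fscale mat_bracket_entries inv_form_entries field_simps)
  qed
qed

definition loop_op :: "(int \<Rightarrow>\<^sub>0 mat2) \<Rightarrow> fock \<Rightarrow> fock" where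
  "loop_op u v = (\<Sum>m\<in>Poly_Mapping.keys u. mode_op m (Poly_Mapping.lookup u m) v)"

lemma loop_op_add: "loop_op (u + u') v = loop_op u v + loop_op u' v"
  unfolding loop_op_def by (rule setsum_keys_plus_distrib) (simp_all add: mode_op_linear)

lemma loop_op_zero: "loop_op 0 v = 0"
  by (simp add: loop_op_def)

lemma loop_op_diff: "loop_op (u - u') v = loop_op u v - loop_op u' v"
  using loop_op_add[of "u - u'" u' v] by simp

lemma loop_op_sum: "loop_op (sum f S) v = (\<Sum>x\<in>S. loop_op (f x) v)"
  by (induction S rule: infinite_finite_induct) (simp_all add: loop_op_add loop_op_zero)

lemma loop_op_single: "loop_op (Poly_Mapping.single m a) v = mode_op m a v"
  by (cases "a = 0") (simp_all add: loop_op_def mode_op_linear)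

lemma loop_op_scale: "loop_op (Poly_Mapping.map (mat_scale z) u) v = fscale z (loop_op u v)"
proof -
  have lookup: "Poly_Mapping.lookup (Poly_Mapping.map (mat_scale z) u) m = mat_scale z (Poly_Mapping.lookup u m)" for m
    by (simp add: Poly_Mapping.map.rep_eq when_def)
  then have "Poly_Mapping.keys (Poly_Mapping.map (mat_scale z) u) \<subseteq> Poly_Mapping.keys u"
    by (auto simp: in_keys_iff)
  then have "loop_op (Poly_Mapping.map (mat_scale z) u) v =
      (\<Sum>m\<in>Poly_Mapping.keys u. mode_op m (mat_scale z (Poly_Mapping.lookup u m)) v)"
    unfolding loop_op_def lookup
    by (intro sum.mono_neutral_left) (auto simp: in_keys_iff lookup mode_op_linear)
  then show ?thesis by (simp add: mode_op_linear loop_op_def fock.vs1.scale_sum_right)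
qed

lemma flinear_loop_op: "flinear (loop_op u)"
proof (rule flinearI)
  note lin = flinearD[OF graded_op_linear[OF graded_mode_op]]
  show "loop_op u (v + w) = loop_op u v + loop_op u w" for v w
    by (simp add: loop_op_def lin sum.distrib)
  show "loop_op u (fscale z v) = fscale z (loop_op u v)" for z v
    by (simp add: loop_op_def lin fock.vs1.scale_sum_right)
qed

lemma loop_op_bracket:
  assumes "\<And>m. twisted m (Poly_Mapping.lookup u m)" "\<And>m. twisted m (Poly_Mapping.lookup u' m)"
  shows "loop_op u (loop_op u' v) - loop_op u' (loop_op u v) =
    loop_op (loop_bracket u u') v + fscale (k * cocycle u u') v"
proof -
  let ?L = "\<lambda>m. mode_op m (Poly_Mapping.lookup u m)" and ?L' = "\<lambda>n. mode_op n (Poly_Mapping.lookup u' n)"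
  have sum: "mode_op m a (sum f S) = (\<Sum>x\<in>S. mode_op m a (f x))" for m a S and f :: "int \<Rightarrow> fock"
    by (rule fock.linear_sum[OF graded_op_linear[OF graded_mode_op]])
  have "loop_op u (loop_op u' v) - loop_op u' (loop_op u v) =
     (\<Sum>m\<in>Poly_Mapping.keys u. \<Sum>n\<in>Poly_Mapping.keys u'. ?L m (?L' n v)) -
     (\<Sum>n\<in>Poly_Mapping.keys u'. \<Sum>m\<in>Poly_Mapping.keys u. ?L' n (?L m v))"
    by (simp only: loop_op_def sum)
  also have "\<dots> = (\<Sum>m\<in>Poly_Mapping.keys u. \<Sum>n\<in>Poly_Mapping.keys u'. ?L m (?L' n v) - ?L' n (?L m v))"
    by (subst sum.swap[of _ "Poly_Mapping.keys u"]) (simp only: sum_subtractf)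
  also have "\<dots> = loop_op (loop_bracket u u') v + fscale (k * cocycle u u') v"
    by (simp only: mode_op_commutator[OF assms] sum.distrib loop_bracket_def loop_op_sum loop_op_single
        cocycle_def sum_distrib_left fock.vs1.scale_sum_left)
  finally show ?thesis .
qed

lemma loop_op_grading:
  "grading j k (loop_op u v) = loop_op u (grading j k v) - loop_op (loop_deriv u) v"
proof -
  have "grading j k (loop_op u v) = (\<Sum>m\<in>Poly_Mapping.keys u. grading j k (mode_op m (Poly_Mapping.lookup u m) v))"
    unfolding loop_op_def by (rule fock.linear_sum[OF flinear_grading])
  then show ?thesis
    by (simp add: graded_op_grading[OF graded_mode_op] sum_subtractf loop_deriv_def loop_op_sum
        loop_op_single mode_op_linear loop_op_def[of u])
qed

definition affine_rep :: "affine \<Rightarrow> fock \<Rightarrow> fock" where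
  "affine_rep = (\<lambda>(u, r, s) v. loop_op u v + fscale (k * r) v - fscale s (grading j k v))"

lemma is_affine_rep_affine_rep: "is_affine_rep affine_rep"
  unfolding is_affine_rep_def
proof (intro conjI ballI allI)
  note loopD = flinearD[OF flinear_loop_op] and gradingD = flinearD[OF flinear_grading]
  show "flinear (affine_rep a)" for a
    by (cases a, rule flinearI)
       (simp_all add: affine_rep_def loopD gradingD fscale_simps mult.commute)
  show "affine_rep (a + b) v = affine_rep a v + affine_rep b v" for a b v
    by (cases a; cases b)
       (simp add: affine_rep_def loop_op_add fock.vs1.scale_left_distrib distrib_left)
  show "affine_rep (affine_scale z a) v = fscale z (affine_rep a v)" for z a v
    by (cases a) (simp add: affine_rep_def affine_scale_def loop_op_scale fscale_simps mult_ac)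
  show "affine_rep (affine_bracket a b) v = affine_rep a (affine_rep b v) - affine_rep b (affine_rep a v)"
    if ab: "a \<in> affine_sl2" "b \<in> affine_sl2" for a b v
  proof -
    obtain u r s u' r' s' where [simp]: "a = (u, r, s)" "b = (u', r', s')"
      by (metis prod_cases3)
    have "\<And>m. twisted m (Poly_Mapping.lookup u m)" "\<And>m. twisted m (Poly_Mapping.lookup u' m)"
      using ab affine_sl2_twisted by auto
    from loop_op_bracket[OF this, of v]
    have *: "loop_op u (loop_op u' v) = loop_op u' (loop_op u v) +
        loop_op (loop_bracket u u') v + fscale (k * cocycle u u') v"
      by (simp add: algebra_simps)
    show ?thesis
      by (simp add: affine_rep_def affine_bracket_def loop_op_add loop_op_diff loop_op_scale loopD gradingD
          loop_op_grading * fscale_simps mult_ac)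
  qed
qed

lemma affine_rep_beta:
  assumes "odd n"
  shows "affine_rep (beta_elem n) = beta_series j k n"
proof
  show "affine_rep (beta_elem n) v = beta_series j k n v" for v
    using assms
    by (auto simp: affine_rep_def beta_elem_def tensor_t_def loop_op_single mode_op_def beta_series_def
        series_scale_def series_D_def phi_series_def sl2_e_def sl2_f_def)
qed

lemma affine_rep_x: "affine_rep (x_elem n) = x_series j k n"
proof
  have "x_series j k n v = fscale (1/2) (current n v)" for v
    by (simp add: x_series_def current_def boson_def exponent_def series_scale_def)
  then show "affine_rep (x_elem n) v = x_series j k n v" for v
    by (auto simp: affine_rep_def x_elem_def tensor_t_def loop_op_single mode_op_def
        sl2_e_def sl2_f_def sl2_h_def)
qed

end

theorem proposition2p1:
  fixes j k :: complex
  assumes "k \<noteq> 0" and "k \<noteq> -2"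
  shows "\<exists>\<pi>. is_affine_rep \<pi> \<and> has_level k \<pi>
           \<and> (\<forall>n. odd n \<longrightarrow> \<pi> (beta_elem n) = beta_series j k n)
           \<and> (\<forall>n. \<pi> (x_elem n) = x_series j k n)
           \<and> \<pi> rho_elem = (\<lambda>v. - grading j k v)"
proof -
  interpret fock_level j k using assms by unfold_locales
  have "has_level k affine_rep"
    by (simp add: has_level_def affine_rep_def c_elem_def loop_op_zero)
  moreover have "affine_rep rho_elem = (\<lambda>v. - grading j k v)"
    by (simp add: fun_eq_iff affine_rep_def rho_elem_def loop_op_zero)
  ultimately show ?thesis
    using is_affine_rep_affine_rep affine_rep_beta affine_rep_x by blast
qed

end
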